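(* Let $\mu$ be any partition of $n$. Then the family $\{\partial_S\Delta_\mu\}_{S\in{\cal S}}$ is a basis of $M_\mu^0$.
   Context: Polynomials are in the variables $x_1,\dots,x_n,y_1,\dots,y_n$ with coefficients in $\mathbb{Q}$. For a partition $\mu=(\mu_1\ge\dots\ge\mu_k>0)$ of $n$, the biexponents of $\mu$ are the pairs $(i-1,j-1)$ with $1\le i\le k$, $1\le j\le\mu_i$ ($i$ is the row index, $j$ the position in the row). Listing them in lexicographic order as $(p_1,q_1),\dots,(p_n,q_n)$, set $$\Delta_\mu(x,y)=\det\big(x_i^{p_j}y_i^{q_j}\big)_{i,j=1,\dots,n}.$$ $M_\mu$ is the linear span of all partial derivatives (of all orders, including order $0$) of $\Delta_\mu$ with respect to the variables $x_i,y_i$, and $M_\mu^0$ is the subspace of the elements of $M_\mu$ that have degree $0$ in $x$ (i.e. involve only $y_1,\dots,y_n$). Drawings. A drawing associated to $\mu$ consists of $n-1$ bars at places $1,\dots,n-1$ from left to right. A bar of type $(p,q)$ consists of $p$ $x$-cells (below an axis; $p$ is its depth) and $q$ $y$-cells (above the axis; $q$ is its height). The types of the $n-1$ bars are the biexponents of $\mu$ other than $(0,0)$, each used exactly once. Each cell either contains a cross or is white; only the numbers of crossed $x$-cells and crossed $y$-cells in each bar matter. The rules are: (1) bars having the same number of $x$-cells are placed in decreasing order of height from left to right; (2) every $x$-cell contains a cross; (3) whenever a bar is placed to the left of (not necessarily adjacent to) a bar having more $x$-cells than it and having $q$ $y$-cells, the first bar must have at least $q+1$ white $y$-cells. To a drawing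 one associates its collection $S$ of crossed cells, recorded as the number $a_i$ of crossed $x$-cells and the number $b_i$ of crossed $y$-cells at each place $i$ ($1\le i\le n-1$). ${\cal S}$ is the set of all $S$ obtained from drawings satisfying these rules, and $\partial_S=\prod_{i=1}^{n-1}\partial_{x_i}^{a_i}\partial_{y_i}^{b_i}$. *)

theory Defs
  imports
    "HOL-Library.Poly_Mapping"
    "Jordan_Normal_Form.Determinant"
begin

(* Indices are shifted to start at 0: x_i and y_i (1 <= i <= n) are Xvar (i - 1) and
   Yvar (i - 1), and place i of a drawing is list position i - 1. *)

datatype var = Xvar nat | Yvar nat

type_synonym monom = "var \<Rightarrow>\<^sub>0 nat"

type_synonym mpoly = "monom \<Rightarrow>\<^sub>0 rat"

definition Var :: "var \<Rightarrow> mpoly" where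
  "Var v = Poly_Mapping.single (Poly_Mapping.single v 1) 1"

definition scale :: "rat \<Rightarrow> mpoly \<Rightarrow> mpoly" where
  "scale c p = Poly_Mapping.single 0 c * p"

global_interpretation mpoly: vector_space scale
  by standard (auto simp: scale_def algebra_simps single_add mult_single simp flip: mult.assoc)

text \<open>When the exponent of \<open>v\<close> in \<open>m\<close> is \<open>0\<close>, the truncated subtraction is harmless, since
  the coefficient vanishes.\<close>

definition partial_deriv :: "var \<Rightarrow> mpoly \<Rightarrow> mpoly" where
  "partial_deriv v p =
     (\<Sum>m\<in>Poly_Mapping.keys p.
        Poly_Mapping.single (m - Poly_Mapping.single v 1)
          (of_nat (Poly_Mapping.lookup m v) * Poly_Mapping.lookup p m))"

definition is_partition :: "nat list \<Rightarrow> nat \<Rightarrow> bool" where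
  "is_partition \<mu> n \<longleftrightarrow> sorted_wrt (\<ge>) \<mu> \<and> (\<forall>k\<in>set \<mu>. 0 < k) \<and> sum_list \<mu> = n"

text \<open>The comprehension enumerates the pairs in lexicographic order.\<close>

definition biexponents :: "nat list \<Rightarrow> (nat \<times> nat) list" where
  "biexponents \<mu> = [(i, j). i \<leftarrow> [0..<length \<mu>], j \<leftarrow> [0..<\<mu> ! i]]"

definition Delta :: "nat \<Rightarrow> nat list \<Rightarrow> mpoly" where
  "Delta n \<mu> = det (mat n n (\<lambda>(i, j).
     Var (Xvar i) ^ fst (biexponents \<mu> ! j) * Var (Yvar i) ^ snd (biexponents \<mu> ! j)))"

definition M_space :: "nat \<Rightarrow> nat list \<Rightarrow> mpoly set" where
  "M_space n \<mu> = mpoly.span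
     {foldr partial_deriv vs (Delta n \<mu>) | vs. set vs \<subseteq> Xvar ` {..<n} \<union> Yvar ` {..<n}}"

definition M0_space :: "nat \<Rightarrow> nat list \<Rightarrow> mpoly set" where
  "M0_space n \<mu> =
     {p \<in> M_space n \<mu>. \<forall>m\<in>Poly_Mapping.keys p. \<forall>i. Poly_Mapping.lookup m (Xvar i) = 0}"

datatype bar = Bar (depth: nat) (height: nat) (xcrosses: nat) (ycrosses: nat)

definition bar_type :: "bar \<Rightarrow> nat \<times> nat" where
  "bar_type b = (depth b, height b)"

definition white_ycells :: "bar \<Rightarrow> nat" where
  "white_ycells b = height b - ycrosses b"

text \<open>A drawing is the list of its bars from left to right. The first two conditions force
  a drawing for a partition of \<open>n\<close> to have \<open>n - 1\<close> bars.\<close>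

definition is_drawing :: "nat list \<Rightarrow> bar list \<Rightarrow> bool" where
  "is_drawing \<mu> D \<longleftrightarrow>
     distinct (map bar_type D) \<and>
     set (map bar_type D) = set (biexponents \<mu>) - {(0, 0)} \<and>
     (\<forall>b\<in>set D. xcrosses b \<le> depth b \<and> ycrosses b \<le> height b)"

definition obeys_rules :: "bar list \<Rightarrow> bool" where
  "obeys_rules D \<longleftrightarrow>
     sorted_wrt (\<lambda>b c. depth b = depth c \<longrightarrow> height b > height c) D \<and>
     (\<forall>b\<in>set D. xcrosses b = depth b) \<and>
     sorted_wrt (\<lambda>b c. depth b < depth c \<longrightarrow> white_ycells b \<ge> height c + 1) D"

text \<open>The collection of crossed cells is recorded as the list of the pairs \<open>(a\<^sub>i, b\<^sub>i)\<close>.\<close>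

definition crossed_cells :: "bar list \<Rightarrow> (nat \<times> nat) list" where
  "crossed_cells D = map (\<lambda>b. (xcrosses b, ycrosses b)) D"

definition crossed_collections :: "nat list \<Rightarrow> (nat \<times> nat) list set" where
  "crossed_collections \<mu> = crossed_cells ` {D. is_drawing \<mu> D \<and> obeys_rules D}"

definition deriv_S :: "(nat \<times> nat) list \<Rightarrow> mpoly \<Rightarrow> mpoly" where
  "deriv_S S p = foldr (\<lambda>i q.
     (partial_deriv (Xvar i) ^^ fst (S ! i)) ((partial_deriv (Yvar i) ^^ snd (S ! i)) q))
     [0..<length S] p"

end

theory Submission
  imports Defs
begin

text \<open>Every \<open>x\<close>-derivative available must be spent to reach \<open>x\<close>-degree \<open>0\<close>, so an element of \<open>M\<^sub>\<mu>\<^sup>0\<close>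
comes from \<open>y\<close>-derivatives of \<open>\<partial>\<^bsub>x\<^esub>\<^sup>a \<Delta>\<^sub>\<mu>\<close>, which up to a scalar is a product of Vandermonde
determinants in the \<open>y\<close>'s, one for each row of \<open>\<mu>\<close>.  The proof peels off the first place.

Multiply the coefficient of each monomial by the factorials of its exponents.  Partial derivatives
then become shifts of exponents, and \<open>\<Delta>\<^sub>\<mu>\<close> becomes a function \<open>F\<close> on lists of \<open>n\<close> cells (one for each
place) which is alternating and is nonzero exactly on the enumerations of the cells of \<open>\<mu>\<close>.  Only
these two properties of \<open>F\<close> are used, and \<open>P \<mapsto> F (c # P)\<close> has them for the diagram without the
cell \<open>c\<close> (\<open>alternating_on_Cons\<close>).  This is what makes an induction on \<open>n\<close> possible.

The drawings obey the same recursion.  Complete every drawing by a last bar of type \<open>(0, 0)\<close>.  The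
rules force the first bar to be the tallest of its depth \<open>p\<close> and to have at least \<open>\<mu>\<^bsub>p+1\<^esub>\<close> white
\<open>y\<close>-cells (rows are counted from \<open>0\<close>); so row \<open>p\<close> ends in a corner, and the other bars
form a drawing for \<open>\<mu>\<close> without that corner (\<open>crossed_cells_padded_drawings\<close>).  The number \<open>w\<close> of
white cells of the first bar determines \<open>p\<close> by \<open>\<mu>\<^bsub>p+1\<^esub> \<le> w < \<mu>\<^sub>p\<close>, and each \<open>w < \<mu>\<^sub>0\<close> occurs.  Moreover
\<open>w\<close> is the degree of \<open>\<partial>\<^sub>S \<Delta>\<^sub>\<mu>\<close> in the first variable \<open>y\<close>, and its leading coefficient is the
derivative that belongs to the remaining drawing.  Linear independence follows at once by induction
(\<open>corner_collections_independent\<close>).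

Spanning needs an upper bound on \<open>M\<^sub>\<mu>\<^sup>0\<close>.  It is given by the equations of Tanisaki: if \<open>T\<close> is a set of
places whose complement has \<open>c\<close> elements, then the elementary symmetric operator \<open>e\<^sub>r\<close> in the
\<open>\<partial>/\<partial>y\<^sub>i\<close> with \<open>i \<in> T\<close> kills \<open>M\<^sub>\<mu>\<^sup>0\<close> as soon as \<open>r + c > \<mu>\<^sub>0 + \<dots> + \<mu>\<^bsub>c-1\<^esub>\<close>.  Two facts make these
equations work.  They hold for \<open>M\<^sub>\<mu>\<^sup>0\<close> (\<open>add_exponents_in_tanisaki_kernel\<close>).  And they pass to leading
coefficients: if a solution for \<open>\<mu>\<close> has degree \<open>w\<close> in the first variable, then \<open>w < \<mu>\<^sub>0\<close>, and its
leading coefficient solves the equations for \<open>\<mu>\<close> without the corner of the row \<open>p\<close> determined by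
\<open>w\<close> (\<open>tanisaki_kernel_first_degree\<close>, \<open>tanisaki_kernel_leading_coeff\<close>).  Hence, by induction on
\<open>n\<close> and then on \<open>w\<close>, each solution is a combination of the \<open>\<partial>\<^sub>S \<Delta>\<^sub>\<mu>\<close> (\<open>corner_collections_span\<close>).\<close>

section \<open>Alternating functions on lists\<close>

text \<open>On lists of length \<open>card X\<close> this says that \<open>F\<close> is the indicator of the enumerations of \<open>X\<close>, up to
signs and a nonzero scalar.  The signs and the scalar are left open so that they never have to be
computed when a place is peeled off.\<close>

definition alternating_on :: "'a set \<Rightarrow> ('a list \<Rightarrow> rat) \<Rightarrow> bool" where
  "alternating_on X F \<longleftrightarrow>
     (\<forall>P. length P = card X \<longrightarrow> (F P \<noteq> 0 \<longleftrightarrow> distinct P \<and> set P = X)) \<and>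
     (\<forall>P i j. length P = card X \<longrightarrow> i < length P \<longrightarrow> j < length P \<longrightarrow> i \<noteq> j \<longrightarrow>
        F (P[i := P ! j, j := P ! i]) = - F P)"

lemma alternating_on_nonzero_iff:
  assumes "alternating_on X F" "length P = card X"
  shows "F P \<noteq> 0 \<longleftrightarrow> distinct P \<and> set P = X"
  using assms unfolding alternating_on_def by blast

lemma alternating_on_swap:
  assumes "alternating_on X F" "length P = card X" "i < card X" "j < card X" "i \<noteq> j"
  shows "F (P[i := P ! j, j := P ! i]) = - F P"
  using assms unfolding alternating_on_def by metis

text \<open>For a determinant this is the Laplace expansion along a row with a single nonzero entry.\<close>

lemma alternating_on_Cons:
  assumes F: "alternating_on X F" and x: "x \<in> X" and fin: "finite X"
  shows "alternating_on (X - {x}) (\<lambda>P. F (x # P))"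
proof -
  have card: "length (x # P) = card X" if "length P = card (X - {x})" for P :: "'a list"
    using that card_Suc_Diff1[OF fin x] by simp
  have 1: "F (x # P) \<noteq> 0 \<longleftrightarrow> distinct P \<and> set P = X - {x}" if "length P = card (X - {x})" for P
    using alternating_on_nonzero_iff[OF F card[OF that]] x by auto
  have 2: "F (x # P[i := P ! j, j := P ! i]) = - F (x # P)"
    if P: "length P = card (X - {x})" and ij: "i < length P" "j < length P" "i \<noteq> j" for P i j
    using alternating_on_swap[OF F card[OF P], of "Suc i" "Suc j"] ij card[OF P] by simp
  show ?thesis unfolding alternating_on_def using 1 2 by simp
qed

section \<open>Row lengths and corners\<close>

text \<open>Partitions are handled as functions from rows to row lengths, eventually \<open>0\<close>, because removing a
corner may empty the last row.\<close>

definition cells :: "(nat \<Rightarrow> nat) \<Rightarrow> (nat \<times> nat) set" where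
  "cells m = {(i, j). j < m i}"

definition diagram :: "nat \<Rightarrow> (nat \<Rightarrow> nat) \<Rightarrow> bool" where
  "diagram n m \<longleftrightarrow> antimono m \<and> finite (cells m) \<and> card (cells m) = n"

text \<open>The possible first bars of a completed drawing: its depth \<open>p\<close> and its number \<open>b\<close> of crossed
\<open>y\<close>-cells.  Its height is \<open>m p - 1\<close>, so it has \<open>m p - 1 - b\<close> white \<open>y\<close>-cells, and the inequality says
that these are at least \<open>m (p + 1)\<close>.\<close>

definition corner_choices :: "(nat \<Rightarrow> nat) \<Rightarrow> (nat \<times> nat) set" where
  "corner_choices m = {(p, b). m (Suc p) + b < m p}"

abbreviation remove_corner :: "nat \<Rightarrow> (nat \<Rightarrow> nat) \<Rightarrow> (nat \<Rightarrow> nat)" where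
  "remove_corner p m \<equiv> m(p := m p - 1)"

lemma cells_remove_corner: "cells (remove_corner p m) = cells m - {(p, m p - 1)}"
  by (auto simp: cells_def split: if_splits)

lemma diagram_antimono: "diagram n m \<Longrightarrow> i \<le> j \<Longrightarrow> m j \<le> m i"
  unfolding diagram_def by (blast dest: antimonoD)

lemma diagram_remove_corner:
  assumes m: "diagram (Suc n) m" and p: "m (Suc p) < m p"
  shows "diagram n (remove_corner p m)"
proof -
  note mono = diagram_antimono[OF m]
  have "remove_corner p m j \<le> remove_corner p m i" if ij: "i \<le> j" for i j
  proof (cases "i = p \<and> j \<noteq> p")
    case True
    with ij have "Suc p \<le> j" by simp
    from mono[OF this] p True show ?thesis by simp
  next
    case False
    then show ?thesis using mono[OF ij] by auto
  qed
  then have "antimono (remove_corner p m)" unfolding antimono_def by blast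
  moreover have "(p, m p - 1) \<in> cells m" using p by (simp add: cells_def)
  ultimately show ?thesis
    using m unfolding diagram_def cells_remove_corner by simp
qed

lemma corner_of_column:
  assumes m: "diagram n m" and w: "w < m 0"
  obtains p where "m (Suc p) \<le> w" "w < m p"
proof -
  have "\<exists>i. m i = 0"
  proof (rule ccontr)
    assume "\<nexists>i. m i = 0"
    then have "range (\<lambda>i. (i, 0)) \<subseteq> cells m" by (auto simp: cells_def)
    moreover have "infinite (range (\<lambda>i::nat. (i, 0::nat)))"
      by (rule range_inj_infinite) (simp add: inj_on_def)
    ultimately show False using m finite_subset unfolding diagram_def by blast
  qed
  then obtain i where "m i \<le> w" by (metis zero_le)
  then have "\<exists>p. \<not> w < m p" by (meson not_le)
  with w obtain p where "w < m p" "\<not> w < m (Suc p)"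
    using exists_least_lemma[of "\<lambda>p. \<not> w < m p"] by blast
  then show thesis using that[of p] by simp
qed

text \<open>The intervals \<open>{m (p + 1)..<m p}\<close> are disjoint, so the number of white cells of the first bar
determines the bar.\<close>

lemma corner_choices_unique:
  assumes m: "diagram n m"
    and "(p, b) \<in> corner_choices m" "(p', b') \<in> corner_choices m"
    and eq: "m p - 1 - b = m p' - 1 - b'"
  shows "p = p' \<and> b = b'"
proof -
  note mono = diagram_antimono[OF m]
  have c: "m (Suc p) + b < m p" "m (Suc p') + b' < m p'"
    using assms by (auto simp: corner_choices_def)
  have "\<not> p < p'"
    using mono[of "Suc p" p'] c eq by (intro notI) simp
  moreover have "\<not> p' < p"
    using mono[of "Suc p'" p] c eq by (intro notI) simp
  ultimately show ?thesis using c eq by auto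
qed

lemma finite_corner_choices:
  assumes "diagram n m" shows "finite (corner_choices m)"
proof -
  have "corner_choices m \<subseteq> cells m" by (auto simp: corner_choices_def cells_def)
  with assms show ?thesis using finite_subset unfolding diagram_def by blast
qed

section \<open>Collections obtained by removing corners\<close>

fun corner_collections :: "nat \<Rightarrow> (nat \<Rightarrow> nat) \<Rightarrow> (nat \<times> nat) list set" where
  "corner_collections 0 m = {[]}"
| "corner_collections (Suc n) m =
     (\<Union>(p, b)\<in>corner_choices m. Cons (p, b) ` corner_collections n (remove_corner p m))"

lemma finite_corner_collections: "diagram n m \<Longrightarrow> finite (corner_collections n m)"
proof (induction n arbitrary: m)
  case (Suc n)
  show ?case
    unfolding corner_collections.simps
    using Suc.IH diagram_remove_corner[OF Suc.prems]
    by (intro finite_UN_I finite_corner_choices[OF Suc.prems])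
       (auto simp: corner_choices_def simp del: fun_upd_apply One_nat_def)
qed simp

lemma length_corner_collections: "S \<in> corner_collections n m \<Longrightarrow> length S = n"
  by (induction n arbitrary: m S) auto

text \<open>If \<open>F\<close> comes from \<open>\<Delta>\<^sub>\<mu>\<close>, then \<open>F (add_exponents S k)\<close> is the weighted coefficient of \<open>\<Prod> y\<^sub>i ^ k\<^sub>i\<close>
in \<open>\<partial>\<^sub>S \<Delta>\<^sub>\<mu>\<close>.\<close>

definition add_exponents :: "(nat \<times> nat) list \<Rightarrow> nat list \<Rightarrow> (nat \<times> nat) list" where
  "add_exponents S k = map2 (\<lambda>(a, b) q. (a, b + q)) S k"

lemma add_exponents_Cons [simp]: "add_exponents ((a, b) # S) (q # k) = (a, b + q) # add_exponents S k"
  by (simp add: add_exponents_def)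

lemma length_add_exponents [simp]: "length (add_exponents S k) = min (length S) (length k)"
  by (simp add: add_exponents_def)

lemma nth_add_exponents:
  "i < length S \<Longrightarrow> i < length k \<Longrightarrow> add_exponents S k ! i = (fst (S ! i), snd (S ! i) + k ! i)"
  by (simp add: add_exponents_def split_beta)

lemma corner_mem_cells:
  "(p, b) \<in> corner_choices m \<Longrightarrow> (p, m p - 1) \<in> cells m"
  by (auto simp: corner_choices_def cells_def)

section \<open>Linear independence\<close>

text \<open>Among the collections with a nonzero coefficient take one whose first bar has the largest number \<open>w\<close>
of white cells, that is, of the largest degree in the first variable.  Comparing the terms of degree
\<open>w\<close> leaves only collections with the same first bar, and the relation becomes one for the diagram
without the corner.\<close>

lemma corner_collections_independent:
  assumes "diagram n m" "alternating_on (cells m) F"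
    and "\<And>k. length k = n \<Longrightarrow> (\<Sum>S\<in>corner_collections n m. u S * F (add_exponents S k)) = 0"
    and "S \<in> corner_collections n m"
  shows "u S = 0"
  using assms
proof (induction n arbitrary: m F u S)
  case 0
  then show ?case using alternating_on_nonzero_iff[OF "0.prems"(2), of "[]"]
    by (auto simp: add_exponents_def diagram_def)
next
  case (Suc n)
  note m = Suc.prems(1) and F = Suc.prems(2)
  note fin = finite_corner_collections[OF m]
  show ?case
  proof (rule ccontr)
    define white where "white T = m (fst (hd T)) - 1 - snd (hd T)" for T :: "(nat \<times> nat) list"
    define N where "N = {T \<in> corner_collections (Suc n) m. u T \<noteq> 0}"
    assume "u S \<noteq> 0"
    with Suc.prems(4) have "N \<noteq> {}" unfolding N_def by blast
    moreover have "finite N" using fin unfolding N_def by (rule rev_finite_subset) blast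
    ultimately obtain T where T: "T \<in> N" and "white T = Max (white ` N)"
      using Max_in[of "white ` N"] by fastforce
    then have max: "\<And>T'. T' \<in> N \<Longrightarrow> white T' \<le> white T"
      using \<open>finite N\<close> by simp
    from T have "T \<in> corner_collections (Suc n) m" unfolding N_def by blast
    then obtain p b T0 where pb: "(p, b) \<in> corner_choices m"
      and T0: "T0 \<in> corner_collections n (remove_corner p m)" and T_eq: "T = (p, b) # T0"
      by auto
    define m' where "m' = remove_corner p m"
    define w where "w = m p - 1 - b"
    have bw: "b + w = m p - 1" using pb by (auto simp: w_def corner_choices_def)
    have m': "diagram n m'"
      using diagram_remove_corner[OF m] pb by (auto simp: m'_def corner_choices_def)
    have F': "alternating_on (cells m') (\<lambda>P. F ((p, m p - 1) # P))"
      unfolding m'_def cells_remove_corner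
      using alternating_on_Cons[OF F corner_mem_cells[OF pb]] m by (simp add: diagram_def)
    have "(\<Sum>S\<in>corner_collections n m'. u ((p, b) # S) * F ((p, m p - 1) # add_exponents S k)) = 0"
      if k: "length k = n" for k
    proof -
      let ?f = "\<lambda>S. u S * F (add_exponents S (w # k))"
      have sub: "Cons (p, b) ` corner_collections n m' \<subseteq> corner_collections (Suc n) m"
        using pb by (auto simp: m'_def)
      \<comment> \<open>A nonzero term needs at least \<open>w\<close> white cells in its first bar, as otherwise the shift by \<open>w\<close>
      leaves the row; maximality of \<open>w\<close> gives equality, and the first bar is \<open>(p, b)\<close>.\<close>
      have "?f S = 0" if S: "S \<in> corner_collections (Suc n) m - Cons (p, b) ` corner_collections n m'" for S
      proof (rule ccontr)
        assume nz: "?f S \<noteq> 0"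
        from S obtain p' b' S0 where pb': "(p', b') \<in> corner_choices m"
          and S0: "S0 \<in> corner_collections n (remove_corner p' m)" and S_eq: "S = (p', b') # S0"
          by auto
        have "S \<in> N" using S nz by (auto simp: N_def)
        from max[OF this] have le: "m p' - 1 - b' \<le> w"
          by (simp add: white_def S_eq T_eq w_def)
        have "length (add_exponents S (w # k)) = card (cells m)"
          using m k length_corner_collections[of S "Suc n" m] S by (simp add: diagram_def)
        with nz have "set (add_exponents S (w # k)) = cells m"
          using alternating_on_nonzero_iff[OF F] by simp
        then have "(p', b' + w) \<in> cells m" by (auto simp: S_eq)
        then have "w \<le> m p' - 1 - b'" by (simp add: cells_def)
        with le have "m p' - 1 - b' = m p - 1 - b" by (simp add: w_def)
        from corner_choices_unique[OF m pb' pb this] S S0 S_eq show False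
          by (simp add: m'_def)
      qed
      then have "(\<Sum>S\<in>corner_collections (Suc n) m. ?f S) = (\<Sum>S\<in>Cons (p, b) ` corner_collections n m'. ?f S)"
        using sub fin by (intro sum.mono_neutral_right) auto
      also have "\<dots> = (\<Sum>S\<in>corner_collections n m'. u ((p, b) # S) * F ((p, m p - 1) # add_exponents S k))"
        by (subst sum.reindex) (auto simp: bw inj_on_def)
      finally show ?thesis using Suc.prems(3)[of "w # k"] k by simp
    qed
    from Suc.IH[OF m' F' this, of T0] T0 have "u T = 0" unfolding T_eq m'_def by blast
    with T show False by (simp add: N_def)
  qed
qed

section \<open>The equations of Tanisaki\<close>

text \<open>\<open>ts\<close> is the indicator of a set of places; the elements are the indicators of its subsets of
size \<open>r\<close>.\<close>

definition selections :: "bool list \<Rightarrow> nat \<Rightarrow> bool list set" where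
  "selections ts r = {R. list_all2 (\<longrightarrow>) R ts \<and> count_list R True = r}"

definition increment_at :: "nat list \<Rightarrow> bool list \<Rightarrow> nat list" where
  "increment_at k R = map2 (\<lambda>q s. q + of_bool s) k R"

text \<open>The elementary symmetric polynomial \<open>e\<^sub>r\<close> in the shifts (that is, partial derivatives) at the places
marked by \<open>ts\<close>.\<close>

definition elem_sym_shift :: "bool list \<Rightarrow> nat \<Rightarrow> (nat list \<Rightarrow> rat) \<Rightarrow> nat list \<Rightarrow> rat" where
  "elem_sym_shift ts r g k = (\<Sum>R\<in>selections ts r. g (increment_at k R))"

definition tanisaki_kernel :: "nat \<Rightarrow> (nat \<Rightarrow> nat) \<Rightarrow> (nat list \<Rightarrow> rat) set" where
  "tanisaki_kernel n m = {g. \<forall>ts r k. length ts = n \<longrightarrow> length k = n \<longrightarrow>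
     (\<Sum>j<count_list ts False. m j) < r + count_list ts False \<longrightarrow> elem_sym_shift ts r g k = 0}"

lemma finite_selections: "finite (selections ts r)"
proof -
  have "selections ts r \<subseteq> {R. set R \<subseteq> (UNIV :: bool set) \<and> length R = length ts}"
    by (auto simp: selections_def dest: list_all2_lengthD)
  then show ?thesis by (rule finite_subset) (rule finite_lists_length_eq[OF finite])
qed

lemma length_selections: "R \<in> selections ts r \<Longrightarrow> length R = length ts"
  by (auto simp: selections_def dest: list_all2_lengthD)

lemma length_increment_at [simp]: "length (increment_at k R) = min (length k) (length R)"
  by (simp add: increment_at_def)

lemma increment_at_Cons [simp]: "increment_at (q # k) (s # R) = (q + of_bool s) # increment_at k R"
  by (simp add: increment_at_def)

lemma selections_False_Cons: "selections (False # ts) r = Cons False ` selections ts r"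
  by (auto simp: selections_def list_all2_Cons2 image_iff)

lemma selections_True_Cons_0: "selections (True # ts) 0 = Cons False ` selections ts 0"
  by (auto simp: selections_def list_all2_Cons2 image_iff split: if_splits)

lemma selections_True_Cons_Suc:
  "selections (True # ts) (Suc r) = Cons False ` selections ts (Suc r) \<union> Cons True ` selections ts r"
  by (auto simp: selections_def list_all2_Cons2 image_iff split: if_splits)

lemma elem_sym_shift_False_Cons:
  "elem_sym_shift (False # ts) r g (q # k) = elem_sym_shift ts r (\<lambda>k. g (q # k)) k"
  by (simp add: elem_sym_shift_def selections_False_Cons sum.reindex inj_on_def)

lemma elem_sym_shift_True_Cons_0:
  "elem_sym_shift (True # ts) 0 g (q # k) = elem_sym_shift ts 0 (\<lambda>k. g (q # k)) k"
  by (simp add: elem_sym_shift_def selections_True_Cons_0 sum.reindex inj_on_def)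

text \<open>The recursion \<open>e\<^sub>r(z, Z) = e\<^sub>r(Z) + z e\<^bsub>r-1\<^esub>(Z)\<close>.\<close>

lemma elem_sym_shift_True_Cons_Suc:
  "elem_sym_shift (True # ts) (Suc r) g (q # k) =
     elem_sym_shift ts (Suc r) (\<lambda>k. g (q # k)) k + elem_sym_shift ts r (\<lambda>k. g (Suc q # k)) k"
  unfolding elem_sym_shift_def selections_True_Cons_Suc
  by (subst sum.union_disjoint) (auto simp: finite_selections sum.reindex inj_on_def)

lemma elem_sym_shift_0:
  "elem_sym_shift ts 0 g k = g k" if "length k = length ts"
  using that
proof (induction ts arbitrary: g k)
  case Nil
  have "selections [] 0 = {[]}" by (auto simp: selections_def)
  with Nil show ?case by (simp add: elem_sym_shift_def increment_at_def)
next
  case (Cons t ts)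
  then obtain q k' where "k = q # k'" by (cases k) auto
  with Cons show ?case
    by (cases t) (simp_all add: elem_sym_shift_True_Cons_0 elem_sym_shift_False_Cons)
qed

lemma tanisaki_kernelD:
  assumes "g \<in> tanisaki_kernel n m" "length ts = n" "length k = n"
    "(\<Sum>j<count_list ts False. m j) < r + count_list ts False"
  shows "elem_sym_shift ts r g k = 0"
  using assms unfolding tanisaki_kernel_def by blast

lemma tanisaki_kernel_add:
  "f \<in> tanisaki_kernel n m \<Longrightarrow> g \<in> tanisaki_kernel n m \<Longrightarrow> (\<lambda>k. f k + g k) \<in> tanisaki_kernel n m"
  by (auto simp: tanisaki_kernel_def elem_sym_shift_def sum.distrib)

lemma tanisaki_kernel_scale:
  "f \<in> tanisaki_kernel n m \<Longrightarrow> (\<lambda>k. c * f k) \<in> tanisaki_kernel n m"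
  by (auto simp: tanisaki_kernel_def elem_sym_shift_def simp flip: sum_distrib_left)

lemma tanisaki_kernel_zero: "(\<lambda>k. 0) \<in> tanisaki_kernel n m"
  by (auto simp: tanisaki_kernel_def elem_sym_shift_def)

lemma tanisaki_kernel_sum:
  assumes "\<And>i. i \<in> I \<Longrightarrow> f i \<in> tanisaki_kernel n m"
  shows "(\<lambda>k. \<Sum>i\<in>I. f i k) \<in> tanisaki_kernel n m"
  using assms
  by (induction I rule: infinite_finite_induct)
     (auto simp: tanisaki_kernel_zero intro: tanisaki_kernel_add)

text \<open>Let \<open>Z\<close> be the set of all other derivatives.  The equations for the set of all places give
\<open>e\<^bsub>r+1\<^esub>(Z) g = - \<partial>\<^sub>1 e\<^sub>r(Z) g\<close>, so \<open>e\<^sub>r(Z) g = (-\<partial>\<^sub>1)\<^sup>r g\<close>; by the equations for the places other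
than the first this vanishes for \<open>r = m 0\<close>.\<close>

lemma tanisaki_kernel_first_degree:
  assumes g: "g \<in> tanisaki_kernel (Suc n) m" and k: "length k = n" and q: "m 0 \<le> q"
  shows "g (q # k) = 0"
proof -
  define ts where "ts = replicate n True"
  define E where "E r q = elem_sym_shift ts r (\<lambda>k. g (q # k)) k" for r q
  have len: "length ts = n" "count_list ts False = 0" by (auto simp: ts_def count_list_0_iff)
  have step: "E (Suc r) q + E r (Suc q) = 0" for r q
    using tanisaki_kernelD[OF g, of "True # ts" "q # k" "Suc r"] len k
    by (simp add: E_def elem_sym_shift_True_Cons_Suc)
  have top: "E (m 0) q = 0" for q
    using tanisaki_kernelD[OF g, of "False # ts" "q # k" "m 0"] len k
    by (simp add: E_def elem_sym_shift_False_Cons)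
  \<comment> \<open>The absolute values suppress the sign \<open>(-1)\<^sup>j\<close>.\<close>
  have "j \<le> q \<Longrightarrow> \<bar>E 0 q\<bar> = \<bar>E j (q - j)\<bar>" for j
  proof (induction j)
    case (Suc j)
    have "E j (q - j) = - E (Suc j) (q - Suc j)"
      using step[of j "q - Suc j"] Suc.prems by (simp add: Suc_diff_Suc)
    with Suc show ?case by simp
  qed simp
  from this[OF q] top have "E 0 q = 0" by simp
  then show ?thesis using len k by (simp add: E_def elem_sym_shift_0)
qed

lemma sum_remove_corner:
  "(\<Sum>j<c. remove_corner p m j) = (\<Sum>j<c. m j) - (if p < c \<and> 0 < m p then 1 else 0)"
proof (induction c)
  case (Suc c)
  show ?case
  proof (cases "p < c")
    case True
    have "m p \<le> (\<Sum>j<c. m j)" using True by (intro member_le_sum) auto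
    with Suc True show ?thesis by auto
  qed (use Suc in \<open>auto\<close>)
qed simp

text \<open>Let \<open>Z\<close> be a set of places among the later ones with \<open>c\<close> later places missing.  Two kinds of
equations are available: those for \<open>Z\<close> with the first place added (again \<open>c\<close> missing places), and
those for \<open>Z\<close> itself (\<open>c + 1\<close> missing places).  The first kind reads
\<open>e\<^bsub>r+1\<^esub>(Z) g = - \<partial>\<^sub>1 e\<^sub>r(Z) g\<close> and yields all equations for the leading coefficient except the one
that is new for the smaller diagram, where \<open>c > p\<close> and \<open>r + c\<close> is the sum of the first \<open>c\<close> rows.  In
that case the recursion gives \<open>(-\<partial>\<^sub>1)\<^sup>j e\<^sub>r(Z) g = e\<^bsub>r+j\<^esub>(Z) g\<close>, the second kind kills this for
\<open>j = m c\<close>, and \<open>m c \<le> w\<close>, so that \<open>\<partial>\<^sub>1\<^sup>w e\<^sub>r(Z) g = 0\<close>.\<close>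

lemma tanisaki_kernel_leading_coeff:
  assumes g: "g \<in> tanisaki_kernel (Suc n) m" and m: "antimono m"
    and p: "m (Suc p) \<le> w" "w < m p"
    and top: "\<And>q k. length k = n \<Longrightarrow> w < q \<Longrightarrow> g (q # k) = 0"
  shows "(\<lambda>k. g (w # k)) \<in> tanisaki_kernel n (remove_corner p m)"
  unfolding tanisaki_kernel_def
proof (intro CollectI allI impI)
  fix ts :: "bool list" and r :: nat and k :: "nat list"
  define c where "c = count_list ts False"
  define E where "E r q = elem_sym_shift ts r (\<lambda>k. g (q # k)) k" for r q
  assume ts: "length ts = n" and k: "length k = n"
    and big: "(\<Sum>j<count_list ts False. remove_corner p m j) < r + count_list ts False"
  have E_top: "E r q = 0" if "w < q" for r q
    unfolding E_def elem_sym_shift_def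
    using that k ts by (intro sum.neutral) (auto simp: top dest: length_selections)
  have step: "E (Suc r) q + E r (Suc q) = 0" if "(\<Sum>j<c. m j) < Suc r + c" for r q
    using tanisaki_kernelD[OF g, of "True # ts" "q # k" "Suc r"] ts k that
    by (simp add: E_def c_def elem_sym_shift_True_Cons_Suc)
  have "E r w = 0"
  proof (cases "(\<Sum>j<c. m j) < r + c")
    case True
    show ?thesis
    proof (cases r)
      case 0
      then show ?thesis
        using tanisaki_kernelD[OF g, of "True # ts" "w # k" 0] ts k True
        by (simp add: E_def c_def elem_sym_shift_True_Cons_0)
    next
      case (Suc r')
      then show ?thesis using step[of r' w] E_top[of "Suc w"] True by simp
    qed
  next
    case False
    with big[unfolded sum_remove_corner] p have pc: "p < c" and eq: "r + c = (\<Sum>j<c. m j)"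
      by (auto simp: c_def split: if_splits)
    have mc: "m c \<le> w" using p(1) pc antimonoD[OF m, of "Suc p" c] by simp
    have alt: "j \<le> w \<Longrightarrow> \<bar>E r w\<bar> = \<bar>E (r + j) (w - j)\<bar>" for j
    proof (induction j)
      case (Suc j)
      have "E (r + j) (w - j) = - E (r + Suc j) (w - Suc j)"
        using step[of "r + j" "w - Suc j"] Suc.prems eq by (simp add: Suc_diff_Suc)
      with Suc show ?case by simp
    qed simp
    have "E (r + m c) (w - m c) = 0"
      using tanisaki_kernelD[OF g, of "False # ts" "(w - m c) # k" "r + m c"] ts k eq
      by (simp add: E_def c_def elem_sym_shift_False_Cons)
    then show ?thesis using alt[OF mc] by simp
  qed
  then show "elem_sym_shift ts r (\<lambda>k. g (w # k)) k = 0" by (simp add: E_def)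
qed

section \<open>Alternating functions solve the equations\<close>

lemma sum_antimono_le_initial_sum:
  fixes m :: "nat \<Rightarrow> nat"
  assumes "antimono m" "finite J"
  shows "sum m J \<le> (\<Sum>j<card J. m j)"
  using assms(2)
proof (induction rule: finite_linorder_max_induct)
  case (insert b J)
  have "J \<subseteq> {..<b}" using insert by auto
  then have "card J \<le> b" using card_mono[of "{..<b}" J] by simp
  then have "m b \<le> m (card J)" by (rule antimonoD[OF assms(1)])
  moreover have "b \<notin> J" using insert by blast
  ultimately show ?case using insert by simp
qed simp

lemma count_list_swap:
  assumes "i < length R" "j < length R"
  shows "count_list (R[i := R ! j, j := R ! i]) x = count_list R x"
  using mset_swap[OF assms(2,1)] by (metis count_mset)

lemma count_list_eq_card: "count_list R x = card {i. i < length R \<and> R ! i = x}"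
  by (simp add: count_list_eq_length_filter length_filter_conv_card eq_commute)

text \<open>Exchanging the membership of \<open>i\<close> and \<open>j\<close> permutes the terms of the sum.  As the cells at both
places agree before the shift, the exchange swaps two entries of the argument of \<open>F\<close>.  So
the sum is equal to its own negative.\<close>

lemma elem_sym_shift_alternating_eq_0:
  assumes F: "alternating_on X F" and X: "card X = n"
    and len: "length S = n" "length k = n" "length ts = n"
    and ij: "i < n" "j < n" "i \<noteq> j" "ts ! i" "ts ! j"
    and eq: "add_exponents S k ! i = add_exponents S k ! j"
  shows "elem_sym_shift ts r (\<lambda>k. F (add_exponents S k)) k = 0"
proof -
  define sw where "sw R = R[i := R ! j, j := R ! i]" for R :: "bool list"
  define P where "P R = add_exponents S (increment_at k R)" for R
  have lenP: "length (P R) = n" if "length R = n" for R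
    using that len by (simp add: P_def)
  have nthP: "P R ! l = (fst (S ! l), snd (S ! l) + k ! l + of_bool (R ! l))"
    if "length R = n" "l < n" for R l
    using that len by (simp add: P_def nth_add_exponents increment_at_def)
  have sw_sel: "sw R \<in> selections ts r" if R: "R \<in> selections ts r" for R
  proof -
    have l: "length R = n" using length_selections[OF R] len by simp
    have "list_all2 (\<longrightarrow>) (sw R) ts"
      using R ij len unfolding selections_def sw_def list_all2_conv_all_nth
      by (auto simp: nth_list_update)
    moreover have "count_list (sw R) True = r"
      using R ij l unfolding sw_def by (simp add: count_list_swap selections_def)
    ultimately show ?thesis by (simp add: selections_def)
  qed
  have sw_sw: "sw (sw R) = R" if "R \<in> selections ts r" for R
    using that ij len length_selections[OF that]
    by (intro nth_equalityI) (auto simp: sw_def nth_list_update)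
  have F_sw: "F (P (sw R)) = - F (P R)" if R: "R \<in> selections ts r" for R
  proof -
    have l: "length R = n" using length_selections[OF R] len by simp
    have e: "fst (S ! i) = fst (S ! j)" "snd (S ! i) + k ! i = snd (S ! j) + k ! j"
      using eq ij len by (simp_all add: nth_add_exponents)
    have "P (sw R) = (P R)[i := P R ! j, j := P R ! i]"
    proof (rule nth_equalityI)
      show "P (sw R) ! l = (P R)[i := P R ! j, j := P R ! i] ! l" if "l < length (P (sw R))" for l
        using that l ij e by (auto simp: nthP lenP sw_def nth_list_update)
    qed (use l in \<open>simp add: lenP sw_def\<close>)
    then show ?thesis using alternating_on_swap[OF F, of "P R" i j] ij l X by (simp add: lenP)
  qed
  have "(\<Sum>R\<in>selections ts r. F (P R)) = (\<Sum>R\<in>selections ts r. F (P (sw R)))"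
    by (rule sum.reindex_bij_witness[of _ sw sw]) (auto simp: sw_sel sw_sw)
  also have "\<dots> = - (\<Sum>R\<in>selections ts r. F (P R))"
    by (simp add: F_sw sum_negf)
  finally show ?thesis by (simp add: elem_sym_shift_def P_def)
qed

text \<open>Suppose that \<open>R\<close> turns the list into an enumeration of the cells.  At most \<open>c\<close> rows contain a cell
at an unmarked place, where \<open>c\<close> is the number of unmarked places, and these rows have at most
\<open>m 0 + \<dots> + m (c - 1)\<close> cells, \<open>c\<close> of which lie at unmarked places.  As \<open>r\<close> is too large for all shifted
places to lie in these rows, \<open>R\<close> shifts a place in some row that lies entirely at marked places.  In
such a row, take the shifted place \<open>i\<close> with the leftmost cell.  The cell to the left of it, which is
the cell of \<open>i\<close> before the shift, belongs to a place \<open>j\<close> that is not shifted.\<close>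

lemma exists_repeated_cell:
  assumes m: "diagram n m"
    and len: "length S = n" "length k = n" "length ts = n"
    and big: "(\<Sum>j<count_list ts False. m j) < r + count_list ts False"
    and R: "R \<in> selections ts r"
    and dist: "distinct (add_exponents S (increment_at k R))" and set: "set (add_exponents S (increment_at k R)) = cells m"
  obtains i j where "i < n" "j < n" "i \<noteq> j" "ts ! i" "ts ! j" "add_exponents S k ! i = add_exponents S k ! j"
proof -
  define a where "a i = fst (S ! i)" for i
  define h where "h i = snd (S ! i) + k ! i" for i
  define P where "P = add_exponents S (increment_at k R)"
  have lenR: "length R = n" using length_selections[OF R] len by simp
  have lenP: "length P = n" using lenR len by (simp add: P_def)
  have nthP: "P ! i = (a i, h i + of_bool (R ! i))" if "i < n" for i
    using that len lenR by (simp add: P_def nth_add_exponents increment_at_def a_def h_def)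
  have nthk: "add_exponents S k ! i = (a i, h i)" if "i < n" for i
    using that len by (simp add: nth_add_exponents a_def h_def)
  have inj: "inj_on ((!) P) {..<n}"
    using dist lenP by (auto simp: P_def[symmetric] inj_on_def nth_eq_iff_index_eq)
  have R_ts: "ts ! i" if "R ! i" "i < n" for i
    using R that lenR by (auto simp: selections_def list_all2_conv_all_nth)
  define C where "C = {i. i < n \<and> \<not> ts ! i}"
  \<comment> \<open>The places whose cell lies in a row that also contains the cell of an unmarked place.\<close>
  define hit where "hit = {i. i < n \<and> a i \<in> a ` C}"
  define raised where "raised = {i. i < n \<and> R ! i}"
  have fin: "finite C" "finite hit" "finite raised" by (simp_all add: C_def hit_def raised_def)
  have cC: "card C = count_list ts False" and cr: "card raised = r"
    using R len lenR by (simp_all add: C_def raised_def count_list_eq_card selections_def)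
  have "card hit \<le> card (SIGMA j:a ` C. {..<m j})"
  proof (rule card_inj_on_le[of "(!) P"])
    show "inj_on ((!) P) hit" using inj by (rule inj_on_subset) (auto simp: hit_def)
    have "P ! i \<in> cells m" if "i < n" for i using that set lenP nth_mem[of i P] by (simp add: P_def)
    then show "(!) P ` hit \<subseteq> (SIGMA j:a ` C. {..<m j})"
      by (fastforce simp: hit_def nthP cells_def)
  qed (simp add: fin)
  also have "\<dots> = sum m (a ` C)" using fin by simp
  also have "\<dots> \<le> (\<Sum>j<card (a ` C). m j)"
    using m fin by (intro sum_antimono_le_initial_sum) (simp_all add: diagram_def)
  also have "\<dots> \<le> (\<Sum>j<card C. m j)"
    using card_image_le[OF fin(1), of a] by (intro sum_mono2) auto
  finally have hit_le: "card hit \<le> (\<Sum>j<card C. m j)" .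
  have "\<not> raised \<subseteq> hit"
  proof
    assume "raised \<subseteq> hit"
    then have "raised \<union> C \<subseteq> hit" by (auto simp: C_def hit_def)
    then have "card (raised \<union> C) \<le> card hit" by (rule card_mono[OF fin(2)])
    moreover have "card (raised \<union> C) = card raised + card C"
      using R_ts by (intro card_Un_disjoint fin) (auto simp: raised_def C_def)
    ultimately show False using hit_le big cC cr by simp
  qed
  then obtain i0 where "i0 \<in> raised" "a i0 \<notin> a ` C" by (auto simp: raised_def hit_def)
  then obtain i where i: "i \<in> raised" "a i \<notin> a ` C"
    and least: "\<And>l. l \<in> raised \<Longrightarrow> a l = a i \<Longrightarrow> h i \<le> h l"
    using ex_has_least_nat[of "\<lambda>l. l \<in> raised \<and> a l = a i0" i0 h] by metis
  have "P ! i \<in> cells m" using i set lenP nth_mem[of i P] by (simp add: P_def raised_def)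
  then have "(a i, h i) \<in> set P"
    using i set by (simp add: P_def[symmetric] nthP raised_def cells_def)
  then obtain j where j: "j < n" "P ! j = (a i, h i)" using lenP by (auto simp: in_set_conv_nth)
  have "\<not> R ! j"
  proof
    assume "R ! j"
    then show False using least[of j] j by (auto simp: raised_def nthP)
  qed
  with j have eq: "a j = a i" "h j = h i" by (simp_all add: nthP)
  have "i < n" "i \<noteq> j" using i \<open>\<not> R ! j\<close> by (auto simp: raised_def)
  moreover have "i \<notin> C" "j \<notin> C" using i(2) eq(1) by (metis imageI)+
  then have "ts ! i" "ts ! j" using i j by (auto simp: C_def raised_def)
  ultimately show thesis using that[of i j] j eq by (simp add: nthk)
qed

lemma add_exponents_in_tanisaki_kernel:
  assumes m: "diagram n m" and F: "alternating_on (cells m) F" and S: "length S = n"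
  shows "(\<lambda>k. F (add_exponents S k)) \<in> tanisaki_kernel n m"
  unfolding tanisaki_kernel_def
proof (intro CollectI allI impI)
  fix ts :: "bool list" and r :: nat and k :: "nat list"
  assume len: "length ts = n" "length k = n"
    and big: "(\<Sum>j<count_list ts False. m j) < r + count_list ts False"
  have card: "card (cells m) = n" using m by (simp add: diagram_def)
  show "elem_sym_shift ts r (\<lambda>k. F (add_exponents S k)) k = 0"
  proof (rule ccontr)
    assume nz: "elem_sym_shift ts r (\<lambda>k. F (add_exponents S k)) k \<noteq> 0"
    then obtain R where R: "R \<in> selections ts r" and FR: "F (add_exponents S (increment_at k R)) \<noteq> 0"
      unfolding elem_sym_shift_def by (meson sum.neutral)
    have "length (add_exponents S (increment_at k R)) = card (cells m)"
      using S len length_selections[OF R] card by simp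
    from FR alternating_on_nonzero_iff[OF F this]
    have P: "distinct (add_exponents S (increment_at k R))" "set (add_exponents S (increment_at k R)) = cells m" by auto
    obtain i j where "i < n" "j < n" "i \<noteq> j" "ts ! i" "ts ! j" "add_exponents S k ! i = add_exponents S k ! j"
      by (rule exists_repeated_cell[OF m S len(2,1) big R P])
    from elem_sym_shift_alternating_eq_0[OF F card S len(2,1) this] nz show False by simp
  qed
qed

section \<open>Spanning\<close>

lemma tanisaki_kernel_diff:
  assumes "f \<in> tanisaki_kernel n m" "g \<in> tanisaki_kernel n m"
  shows "(\<lambda>k. f k - g k) \<in> tanisaki_kernel n m"
  using tanisaki_kernel_add[OF assms(1) tanisaki_kernel_scale[OF assms(2), of "-1"]] by simp

text \<open>The leading coefficient in the first variable is a combination for the smaller diagram, by induction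
on \<open>n\<close>.  Putting the bar that belongs to \<open>w\<close> in front of its collections gives an element with the
same leading coefficient, and subtracting it lowers the degree \<open>w\<close>.\<close>

lemma corner_collections_span:
  assumes "diagram n m" "alternating_on (cells m) F" "g \<in> tanisaki_kernel n m"
  shows "\<exists>u. \<forall>k. length k = n \<longrightarrow> g k = (\<Sum>S\<in>corner_collections n m. u S * F (add_exponents S k))"
  using assms
proof (induction n arbitrary: m F g)
  case 0
  have "F [] \<noteq> 0" using alternating_on_nonzero_iff[OF "0.prems"(2), of "[]"] "0.prems"(1)
    by (auto simp: diagram_def)
  then show ?case by (intro exI[of _ "\<lambda>_. g [] / F []"]) (simp add: add_exponents_def)
next
  case (Suc n)
  note m = Suc.prems(1) and F = Suc.prems(2) and outer = Suc.IH
  note fin = finite_corner_collections[OF m]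
  define spanned where "spanned g \<longleftrightarrow> (\<exists>u. \<forall>k. length k = Suc n \<longrightarrow>
    g k = (\<Sum>S\<in>corner_collections (Suc n) m. u S * F (add_exponents S k)))" for g
  have "spanned g"
    if "g \<in> tanisaki_kernel (Suc n) m" "d \<le> m 0"
      "\<And>q k. length k = n \<Longrightarrow> d \<le> q \<Longrightarrow> g (q # k) = 0" for d g
    using that
  proof (induction d arbitrary: g)
    case 0
    then show ?case unfolding spanned_def
      by (intro exI[of _ "\<lambda>_. 0"]) (auto simp: length_Suc_conv)
  next
    case (Suc w)
    note inner = Suc.IH
    obtain p where p: "m (Suc p) \<le> w" "w < m p"
      using corner_of_column[OF m, of w] Suc.prems(2) by auto
    define b where "b = m p - 1 - w"
    define m' where "m' = remove_corner p m"
    have pb: "(p, b) \<in> corner_choices m" and bw: "b + w = m p - 1"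
      using p by (auto simp: corner_choices_def b_def)
    have m': "diagram n m'"
      using diagram_remove_corner[OF m] p by (simp add: m'_def)
    have F': "alternating_on (cells m') (\<lambda>P. F ((p, m p - 1) # P))"
      unfolding m'_def cells_remove_corner
      using alternating_on_Cons[OF F corner_mem_cells[OF pb]] m by (simp add: diagram_def)
    have "(\<lambda>k. g (w # k)) \<in> tanisaki_kernel n m'"
      unfolding m'_def
      using tanisaki_kernel_leading_coeff[OF Suc.prems(1) _ p] m Suc.prems(3)
      by (simp add: diagram_def)
    from outer[OF m' F' this] obtain u where u: "\<And>k. length k = n \<Longrightarrow>
      g (w # k) = (\<Sum>S\<in>corner_collections n m'. u S * F ((p, m p - 1) # add_exponents S k))" by blast
    define g' where "g' k = (\<Sum>S\<in>corner_collections n m'. u S * F (add_exponents ((p, b) # S) k))" for k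
    have g'_mem: "g' \<in> tanisaki_kernel (Suc n) m"
      unfolding g'_def
      by (intro tanisaki_kernel_sum tanisaki_kernel_scale add_exponents_in_tanisaki_kernel[OF m F])
         (simp add: length_corner_collections)
    have g'_top: "g' (q # k) = 0" if "w < q" "length k = n" for q k
      unfolding g'_def
    proof (intro sum.neutral ballI)
      fix S assume S: "S \<in> corner_collections n m'"
      have "(p, b + q) \<notin> cells m" using that bw p by (simp add: cells_def)
      then have "set (add_exponents ((p, b) # S) (q # k)) \<noteq> cells m"
        by (metis list.set_intros(1) add_exponents_Cons)
      moreover have len: "length (add_exponents ((p, b) # S) (q # k)) = card (cells m)"
        using m that length_corner_collections[OF S] by (simp add: diagram_def)
      ultimately show "u S * F (add_exponents ((p, b) # S) (q # k)) = 0"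
        using alternating_on_nonzero_iff[OF F len] by (metis mult_zero_right)
    qed
    \<comment> \<open>The choice \<open>b = m p - 1 - w\<close> makes \<open>g'\<close> agree with \<open>g\<close> in degree \<open>w\<close>.\<close>
    have "spanned (\<lambda>k. g k - g' k)"
    proof (rule inner)
      show "(\<lambda>k. g k - g' k) \<in> tanisaki_kernel (Suc n) m"
        by (rule tanisaki_kernel_diff[OF Suc.prems(1) g'_mem])
      show "w \<le> m 0" using Suc.prems(2) by simp
      show "g (q # k) - g' (q # k) = 0" if "length k = n" "w \<le> q" for q k
        using that Suc.prems(3)[of k q] g'_top[of q k] u[of k]
        by (cases "q = w") (simp_all add: g'_def bw)
    qed
    then obtain v where v: "\<And>k. length k = Suc n \<Longrightarrow>
      g k - g' k = (\<Sum>S\<in>corner_collections (Suc n) m. v S * F (add_exponents S k))"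
      unfolding spanned_def by blast
    define u' where "u' S = (if S \<in> Cons (p, b) ` corner_collections n m' then u (tl S) else 0)" for S
    have sub: "Cons (p, b) ` corner_collections n m' \<subseteq> corner_collections (Suc n) m"
      using pb by (auto simp: m'_def)
    have "g' k = (\<Sum>S\<in>corner_collections (Suc n) m. u' S * F (add_exponents S k))" for k
    proof -
      have "(\<Sum>S\<in>corner_collections (Suc n) m. u' S * F (add_exponents S k))
          = (\<Sum>S\<in>Cons (p, b) ` corner_collections n m'. u' S * F (add_exponents S k))"
        using sub fin by (intro sum.mono_neutral_right) (auto simp: u'_def)
      also have "\<dots> = g' k" by (subst sum.reindex) (auto simp: u'_def g'_def inj_on_def)
      finally show ?thesis ..
    qed
    with v have "g k = (\<Sum>S\<in>corner_collections (Suc n) m. (u' S + v S) * F (add_exponents S k))"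
      if "length k = Suc n" for k
      using that by (simp add: distrib_right sum.distrib diff_eq_eq)
    then show ?case unfolding spanned_def by (intro exI[of _ "\<lambda>S. u' S + v S"]) blast
  qed
  from this[of g "m 0"] Suc.prems show ?case
    using tanisaki_kernel_first_degree[OF Suc.prems(3)] by (simp add: spanned_def)
qed

section \<open>Drawings\<close>

text \<open>Drawings whose bars have the types in \<open>X\<close>.  For the set of all cells, \<open>(0, 0)\<close> included, these are the
drawings completed by a bar of type \<open>(0, 0)\<close>, and they satisfy a recursion that starts with the empty
drawing.\<close>

definition padded_drawing :: "(nat \<times> nat) set \<Rightarrow> bar list \<Rightarrow> bool" where
  "padded_drawing X D \<longleftrightarrow> distinct (map bar_type D) \<and> set (map bar_type D) = X \<and>
     (\<forall>b\<in>set D. ycrosses b \<le> height b) \<and> obeys_rules D"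

lemma obeys_rules_Cons:
  "obeys_rules (b # D) \<longleftrightarrow> xcrosses b = depth b \<and> obeys_rules D \<and>
     (\<forall>c\<in>set D. (depth b = depth c \<longrightarrow> height c < height b) \<and>
       (depth b < depth c \<longrightarrow> height c < white_ycells b))"
  by (auto simp: obeys_rules_def)

text \<open>As bars of equal depth appear in decreasing height, the first bar is the tallest of its depth \<open>p\<close>.
The demand on its white cells is strongest for the tallest bar of depth \<open>p + 1\<close>, since no row further
down is longer; this is the inequality in \<open>corner_choices\<close>.\<close>

lemma padded_drawing_Cons_iff:
  assumes m: "diagram (Suc n) m"
  shows "padded_drawing (cells m) (b # D) \<longleftrightarrow>
     height b = m (depth b) - 1 \<and> xcrosses b = depth b \<and> (depth b, ycrosses b) \<in> corner_choices m \<and>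
     padded_drawing (cells (remove_corner (depth b) m)) D"
    (is "?L \<longleftrightarrow> ?R")
proof -
  define p where "p = depth b"
  have mem: "(depth c, height c) \<in> X" if "set (map bar_type D) = X" "c \<in> set D" for c X
    using that by (auto simp: bar_type_def)
  show ?thesis
  proof
    assume L: ?L
    then have types: "insert (p, height b) (set (map bar_type D)) = cells m"
      and new: "(p, height b) \<notin> set (map bar_type D)"
      and rules: "\<And>c. c \<in> set D \<Longrightarrow> (p = depth c \<longrightarrow> height c < height b) \<and>
         (p < depth c \<longrightarrow> height c < white_ycells b)"
      and yb: "ycrosses b \<le> height b" and xb: "xcrosses b = p"
      by (auto simp: padded_drawing_def obeys_rules_Cons p_def bar_type_def)
    have hb: "height b < m p" using types by (auto simp: cells_def)
    have "height b = m p - 1"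
    proof (rule ccontr)
      assume "height b \<noteq> m p - 1"
      moreover have "(p, m p - 1) \<in> cells m" using hb by (simp add: cells_def)
      ultimately have "(p, m p - 1) \<in> set (map bar_type D)" unfolding types[symmetric] by simp
      then obtain c where "c \<in> set D" "depth c = p" "height c = m p - 1"
        by (auto simp: bar_type_def)
      with rules[of c] hb show False by simp
    qed
    moreover have "m (Suc p) + ycrosses b < m p"
    proof (cases "m (Suc p) = 0")
      case True
      with yb hb show ?thesis by simp
    next
      case False
      then have "(Suc p, m (Suc p) - 1) \<in> cells m" by (simp add: cells_def)
      then have "(Suc p, m (Suc p) - 1) \<in> set (map bar_type D)" unfolding types[symmetric] by simp
      then obtain c where "c \<in> set D" "depth c = Suc p" "height c = m (Suc p) - 1"
        by (auto simp: bar_type_def)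
      with rules[of c] hb False show ?thesis by (simp add: white_ycells_def)
    qed
    moreover have "padded_drawing (cells (remove_corner p m)) D"
      using L types new calculation(1) unfolding cells_remove_corner
      by (auto simp: padded_drawing_def obeys_rules_Cons)
    ultimately show ?R using xb by (simp add: p_def corner_choices_def)
  next
    assume R: ?R
    then have hb: "height b = m p - 1" and cb: "m (Suc p) + ycrosses b < m p"
      and D: "padded_drawing (cells m - {(p, m p - 1)}) D"
      unfolding p_def corner_choices_def cells_remove_corner by blast+
    have types: "set (map bar_type D) = cells m - {(p, m p - 1)}"
      using D unfolding padded_drawing_def by blast
    have rules: "(p = depth c \<longrightarrow> height c < height b) \<and> (p < depth c \<longrightarrow> height c < white_ycells b)"
      if c: "c \<in> set D" for c
    proof -
      from mem[OF types c] have h: "height c < m (depth c)" "depth c = p \<Longrightarrow> height c \<noteq> m p - 1"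
        by (auto simp: cells_def)
      have "m (depth c) \<le> m (Suc p)" if "p < depth c"
        using diagram_antimono[OF m, of "Suc p" "depth c"] that by simp
      with h hb cb show ?thesis by (auto simp: white_ycells_def)
    qed
    have "(p, m p - 1) \<in> cells m" using cb by (simp add: cells_def)
    then show ?L
      using D R types rules hb cb
      by (auto simp: padded_drawing_def obeys_rules_Cons p_def bar_type_def)
  qed
qed

lemma crossed_cells_padded_drawings:
  assumes "diagram n m"
  shows "crossed_cells ` {D. padded_drawing (cells m) D} = corner_collections n m"
  using assms
proof (induction n arbitrary: m)
  case 0
  then have "cells m = {}" by (metis card_0_eq diagram_def)
  then have "{D. padded_drawing (cells m) D} = {[]}"
    by (auto simp: padded_drawing_def obeys_rules_def)
  then show ?case by (simp add: crossed_cells_def)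
next
  case (Suc n)
  note m = Suc.prems
  have IH: "crossed_cells ` {D. padded_drawing (cells (remove_corner p m)) D} =
      corner_collections n (remove_corner p m)" if "(p, b) \<in> corner_choices m" for p b
    using Suc.IH[OF diagram_remove_corner[OF m, of p]] that
    by (simp only: corner_choices_def mem_Collect_eq prod.case)
  have nonempty: "\<not> padded_drawing (cells m) []"
    using m by (auto simp: padded_drawing_def diagram_def)
  show ?case
  proof (intro equalityI subsetI)
    fix S assume "S \<in> crossed_cells ` {D. padded_drawing (cells m) D}"
    then obtain D where D: "padded_drawing (cells m) D" "S = crossed_cells D" by blast
    then obtain b D' where "D = b # D'" using nonempty by (cases D) auto
    with D have S: "S = (depth b, ycrosses b) # crossed_cells D'"
      and b: "(depth b, ycrosses b) \<in> corner_choices m"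
      and "padded_drawing (cells (remove_corner (depth b) m)) D'"
      using padded_drawing_Cons_iff[OF m, of b D'] by (simp_all add: crossed_cells_def)
    then have "crossed_cells D' \<in> corner_collections n (remove_corner (depth b) m)"
      using IH[OF b] by blast
    with S b show "S \<in> corner_collections (Suc n) m" unfolding corner_collections.simps by blast
  next
    fix S assume "S \<in> corner_collections (Suc n) m"
    then obtain p y S' where py: "(p, y) \<in> corner_choices m"
      and S: "S' \<in> corner_collections n (remove_corner p m)" "S = (p, y) # S'"
      unfolding corner_collections.simps by blast
    from S(1) obtain D' where "padded_drawing (cells (remove_corner p m)) D'" "S' = crossed_cells D'"
      unfolding IH[OF py, symmetric] by blast
    then have "padded_drawing (cells m) (Bar p (m p - 1) p y # D')"
      "S = crossed_cells (Bar p (m p - 1) p y # D')"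
      using py S by (simp_all add: padded_drawing_Cons_iff[OF m] crossed_cells_def)
    then show "S \<in> crossed_cells ` {D. padded_drawing (cells m) D}" by blast
  qed
qed

lemma obeys_rules_snoc_origin:
  assumes "(0, 0) \<notin> set (map bar_type D)"
  shows "obeys_rules (D @ [Bar 0 0 0 0]) \<longleftrightarrow> obeys_rules D"
proof -
  have "0 < height c" if "c \<in> set D" "depth c = 0" for c
    using that assms by (force simp: bar_type_def)
  then show ?thesis by (auto simp: obeys_rules_def sorted_wrt_append)
qed

text \<open>A bar of type \<open>(0, 0)\<close> has no white cells, so no deeper bar can be to its right, and no other bar
of depth \<open>0\<close> either, since that bar would be taller.  Hence it is the last bar.\<close>

lemma padded_drawing_iff:
  assumes m: "diagram n m" and origin: "(0, 0) \<in> cells m"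
  shows "padded_drawing (cells m) D \<longleftrightarrow>
    (\<exists>D'. D = D' @ [Bar 0 0 0 0] \<and> padded_drawing (cells m - {(0, 0)}) D')"
proof
  assume D: "padded_drawing (cells m) D"
  then obtain b where b: "b \<in> set D" "depth b = 0" "height b = 0"
    using origin unfolding padded_drawing_def by (force simp: bar_type_def)
  then obtain D1 D2 where D_eq: "D = D1 @ b # D2" by (meson split_list)
  have b_eq: "b = Bar 0 0 0 0"
    using D b unfolding padded_drawing_def obeys_rules_def by (cases b) auto
  have "D2 = []"
  proof (cases D2)
    case (Cons c D3)
    then show ?thesis
      using D b by (auto simp: D_eq padded_drawing_def obeys_rules_def sorted_wrt_append white_ycells_def)
  qed simp
  moreover from this have "(0, 0) \<notin> set (map bar_type D1)" "set (map bar_type D1) = cells m - {(0, 0)}"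
    using D by (auto simp: padded_drawing_def D_eq b_eq bar_type_def)
  moreover from this obeys_rules_snoc_origin[of D1] have "obeys_rules D1"
    using D calculation(1) by (simp add: D_eq b_eq padded_drawing_def)
  ultimately show "\<exists>D'. D = D' @ [Bar 0 0 0 0] \<and> padded_drawing (cells m - {(0, 0)}) D'"
    using D by (intro exI[of _ D1]) (auto simp: padded_drawing_def D_eq b_eq)
next
  assume "\<exists>D'. D = D' @ [Bar 0 0 0 0] \<and> padded_drawing (cells m - {(0, 0)}) D'"
  then obtain D' where D': "D = D' @ [Bar 0 0 0 0]" "padded_drawing (cells m - {(0, 0)}) D'" by blast
  then have types: "set (map bar_type D') = cells m - {(0, 0)}" unfolding padded_drawing_def by blast
  then have "(0, 0) \<notin> set (map bar_type D')" by blast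
  from obeys_rules_snoc_origin[OF this] D' types origin show "padded_drawing (cells m) D"
    by (auto simp: padded_drawing_def bar_type_def)
qed

section \<open>From partitions to row lengths\<close>

text \<open>For \<open>n = 0\<close> there is no cell \<open>(0, 0)\<close>, and drawings are already complete.\<close>

definition add_origin :: "nat \<Rightarrow> (nat \<times> nat) list \<Rightarrow> (nat \<times> nat) list" where
  "add_origin n S = (if n = 0 then S else S @ [(0, 0)])"

lemma inj_add_origin: "inj (add_origin n)"
  by (auto simp: add_origin_def inj_def)

definition row_lengths :: "nat list \<Rightarrow> nat \<Rightarrow> nat" where
  "row_lengths \<mu> i = (if i < length \<mu> then \<mu> ! i else 0)"

lemma set_biexponents: "set (biexponents \<mu>) = cells (row_lengths \<mu>)"
  by (force simp: biexponents_def cells_def row_lengths_def split: if_splits)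

lemma distinct_concat_pairs:
  "distinct is \<Longrightarrow> distinct (concat (map (\<lambda>i. map (Pair i) [0..<f i]) is))"
  by (induction "is") (auto simp: distinct_map inj_on_def)

lemma biexponents_alt: "biexponents \<mu> = concat (map (\<lambda>i. map (Pair i) [0..<\<mu> ! i]) [0..<length \<mu>])"
  by (simp add: biexponents_def map_concat comp_def)

lemma distinct_biexponents: "distinct (biexponents \<mu>)"
  unfolding biexponents_alt by (rule distinct_concat_pairs) simp

lemma length_biexponents: "length (biexponents \<mu>) = sum_list \<mu>"
  by (simp add: biexponents_alt length_concat comp_def map_nth)

lemma diagram_row_lengths:
  assumes "is_partition \<mu> n"
  shows "diagram n (row_lengths \<mu>)"
proof -
  have "antimono (row_lengths \<mu>)"
  proof (rule antimonoI)
    fix i j :: nat assume "i \<le> j"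
    with assms show "row_lengths \<mu> j \<le> row_lengths \<mu> i"
      unfolding is_partition_def row_lengths_def
      by (cases "i = j") (auto simp: sorted_wrt_iff_nth_less)
  qed
  then show ?thesis
    using assms distinct_card[OF distinct_biexponents, of \<mu>] finite_set[of "biexponents \<mu>"]
    unfolding diagram_def set_biexponents by (simp add: length_biexponents is_partition_def)
qed

lemma add_origin_crossed_collections:
  assumes \<mu>: "is_partition \<mu> n"
  shows "add_origin n ` crossed_collections \<mu> = corner_collections n (row_lengths \<mu>)"
proof -
  note m = diagram_row_lengths[OF \<mu>]
  have *: "{D. is_drawing \<mu> D \<and> obeys_rules D} = {D. padded_drawing (cells (row_lengths \<mu>) - {(0, 0)}) D}"
    by (auto simp: is_drawing_def padded_drawing_def set_biexponents obeys_rules_def)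
  show ?thesis
  proof (cases "n = 0")
    case True
    then have "cells (row_lengths \<mu>) = {}" using m by (metis card_0_eq diagram_def)
    then show ?thesis
      using crossed_cells_padded_drawings[OF m] True
      by (simp add: crossed_collections_def * add_origin_def)
  next
    case False
    then obtain i j where "j < row_lengths \<mu> i" using m by (fastforce simp: diagram_def cells_def)
    with diagram_antimono[OF m, of 0 i] have "(0, 0) \<in> cells (row_lengths \<mu>)" by (simp add: cells_def)
    then have "{D. padded_drawing (cells (row_lengths \<mu>)) D} =
        (\<lambda>D. D @ [Bar 0 0 0 0]) ` {D. padded_drawing (cells (row_lengths \<mu>) - {(0, 0)}) D}"
      using padded_drawing_iff[OF m] by auto
    then have "corner_collections n (row_lengths \<mu>) =
        (\<lambda>D. crossed_cells (D @ [Bar 0 0 0 0])) ` {D. padded_drawing (cells (row_lengths \<mu>) - {(0, 0)}) D}"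
      using crossed_cells_padded_drawings[OF m] by (simp add: image_image)
    then show ?thesis
      using False by (simp add: crossed_collections_def * image_image add_origin_def crossed_cells_def)
  qed
qed

section \<open>Derivatives as shifts of weighted coefficients\<close>

definition monom_fact :: "monom \<Rightarrow> rat" where
  "monom_fact m = (\<Prod>v\<in>Poly_Mapping.keys m. fact (Poly_Mapping.lookup m v))"

text \<open>Equivalently, the constant term of \<open>\<partial>\<^sup>m p\<close>.\<close>

definition weighted_coeff :: "mpoly \<Rightarrow> monom \<Rightarrow> rat" where
  "weighted_coeff p m = Poly_Mapping.lookup p m * monom_fact m"

lemma monom_fact_superset:
  "finite A \<Longrightarrow> Poly_Mapping.keys m \<subseteq> A \<Longrightarrow> monom_fact m = (\<Prod>v\<in>A. fact (Poly_Mapping.lookup m v))"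
  unfolding monom_fact_def by (intro prod.mono_neutral_left) (auto simp: in_keys_iff)

lemma monom_fact_nonzero: "monom_fact m \<noteq> 0"
  by (simp add: monom_fact_def)

lemma monom_fact_add_single:
  "monom_fact (m + Poly_Mapping.single v 1) = of_nat (Poly_Mapping.lookup m v + 1) * monom_fact m"
proof -
  let ?A = "insert v (Poly_Mapping.keys m)"
  have "Poly_Mapping.keys (m + Poly_Mapping.single v 1) \<subseteq> ?A"
    by (auto simp: in_keys_iff lookup_add lookup_single when_def split: if_splits)
  then have "monom_fact (m + Poly_Mapping.single v 1) =
      (\<Prod>w\<in>?A. fact (Poly_Mapping.lookup (m + Poly_Mapping.single v 1) w))"
    by (intro monom_fact_superset) auto
  also have "\<dots> = fact (Poly_Mapping.lookup m v + 1) *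
      (\<Prod>w\<in>?A - {v}. fact (Poly_Mapping.lookup (m + Poly_Mapping.single v 1) w))"
    by (subst prod.remove[of ?A v]) (simp_all add: lookup_add)
  also have "(\<Prod>w\<in>?A - {v}. fact (Poly_Mapping.lookup (m + Poly_Mapping.single v 1) w))
      = (\<Prod>w\<in>?A - {v}. fact (Poly_Mapping.lookup m w) :: rat)"
    by (intro prod.cong) (auto simp: lookup_add lookup_single when_def)
  also have "fact (Poly_Mapping.lookup m v + 1) * \<dots> =
      of_nat (Poly_Mapping.lookup m v + 1) * (\<Prod>w\<in>?A. fact (Poly_Mapping.lookup m w))"
    by (subst prod.remove[of ?A v "\<lambda>w. fact (Poly_Mapping.lookup m w)"]) (simp_all add: mult.assoc)
  also have "(\<Prod>w\<in>?A. fact (Poly_Mapping.lookup m w)) = monom_fact m"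
    by (intro monom_fact_superset[symmetric]) auto
  finally show ?thesis .
qed

lemma minus_single_eq_iff:
  fixes m m' :: monom
  assumes "Poly_Mapping.lookup m' v \<noteq> 0"
  shows "m' - Poly_Mapping.single v 1 = m \<longleftrightarrow> m' = m + Poly_Mapping.single v 1"
  using assms
  by (auto simp: poly_mapping_eq_iff fun_eq_iff lookup_add lookup_minus lookup_single when_def)

lemma lookup_partial_deriv:
  "Poly_Mapping.lookup (partial_deriv v p) m =
     of_nat (Poly_Mapping.lookup m v + 1) * Poly_Mapping.lookup p (m + Poly_Mapping.single v 1)"
proof -
  let ?m = "m + Poly_Mapping.single v 1"
  have "Poly_Mapping.lookup (partial_deriv v p) m = (\<Sum>m'\<in>Poly_Mapping.keys p.
      if m' = ?m then of_nat (Poly_Mapping.lookup m' v) * Poly_Mapping.lookup p m' else 0)"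
    unfolding partial_deriv_def lookup_sum
  proof (rule sum.cong[OF refl])
    fix m' assume "m' \<in> Poly_Mapping.keys p"
    show "Poly_Mapping.lookup (Poly_Mapping.single (m' - Poly_Mapping.single v 1)
        (of_nat (Poly_Mapping.lookup m' v) * Poly_Mapping.lookup p m')) m =
      (if m' = ?m then of_nat (Poly_Mapping.lookup m' v) * Poly_Mapping.lookup p m' else 0)"
    proof (cases "Poly_Mapping.lookup m' v = 0")
      case True
      then show ?thesis by (auto simp: lookup_single)
    next
      case False
      from minus_single_eq_iff[OF this, of m] show ?thesis by (simp add: lookup_single when_def)
    qed
  qed
  also have "\<dots> = of_nat (Poly_Mapping.lookup ?m v) * Poly_Mapping.lookup p ?m"
    by (simp add: in_keys_iff)
  finally show ?thesis by (simp add: lookup_add)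
qed

lemma weighted_coeff_partial_deriv: "weighted_coeff (partial_deriv v p) m = weighted_coeff p (m + Poly_Mapping.single v 1)"
  unfolding weighted_coeff_def lookup_partial_deriv monom_fact_add_single by (simp add: mult_ac)

lemma weighted_coeff_foldr_partial_deriv:
  "weighted_coeff (foldr partial_deriv vs p) m = weighted_coeff p (m + (\<Sum>v\<leftarrow>vs. Poly_Mapping.single v 1))"
  by (induction vs arbitrary: m) (simp_all add: weighted_coeff_partial_deriv add_ac)

lemma weighted_coeff_scale: "weighted_coeff (scale c p) m = c * weighted_coeff p m"
proof -
  have "scale c p = Poly_Mapping.map ((*) c) p"
    by (simp add: scale_def mult_map_scale_conv_mult)
  then show ?thesis by (simp add: weighted_coeff_def Poly_Mapping.map.rep_eq when_def)
qed

lemma weighted_coeff_add: "weighted_coeff (p + q) m = weighted_coeff p m + weighted_coeff q m"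
  by (simp add: weighted_coeff_def lookup_add distrib_right)

lemma weighted_coeff_zero: "weighted_coeff 0 m = 0"
  by (simp add: weighted_coeff_def)

lemma weighted_coeff_sum: "weighted_coeff (sum f A) m = (\<Sum>a\<in>A. weighted_coeff (f a) m)"
  by (simp add: weighted_coeff_def lookup_sum sum_distrib_right)

lemma weighted_coeff_eqI: "(\<And>m. weighted_coeff p m = weighted_coeff q m) \<Longrightarrow> p = q"
  by (rule poly_mapping_eqI) (simp add: weighted_coeff_def monom_fact_nonzero)

lemma weighted_coeff_nonzero_iff: "weighted_coeff p m \<noteq> 0 \<longleftrightarrow> m \<in> Poly_Mapping.keys p"
  by (simp add: weighted_coeff_def monom_fact_nonzero in_keys_iff)

text \<open>The monomial in which place \<open>i\<close> has the pair \<open>P ! i\<close> of exponents.\<close>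

definition place_monom :: "(nat \<times> nat) list \<Rightarrow> monom" where
  "place_monom P = (\<Sum>i<length P. Poly_Mapping.single (Xvar i) (fst (P ! i)) + Poly_Mapping.single (Yvar i) (snd (P ! i)))"

lemma lookup_place_monom_X: "Poly_Mapping.lookup (place_monom P) (Xvar i) = (if i < length P then fst (P ! i) else 0)"
  by (simp add: place_monom_def lookup_sum lookup_add lookup_single when_def)

lemma lookup_place_monom_Y: "Poly_Mapping.lookup (place_monom P) (Yvar i) = (if i < length P then snd (P ! i) else 0)"
  by (simp add: place_monom_def lookup_sum lookup_add lookup_single when_def)

lemma monom_eqI:
  fixes m m' :: monom
  assumes "\<And>i. Poly_Mapping.lookup m (Xvar i) = Poly_Mapping.lookup m' (Xvar i)"
    "\<And>i. Poly_Mapping.lookup m (Yvar i) = Poly_Mapping.lookup m' (Yvar i)"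
  shows "m = m'"
proof (rule poly_mapping_eqI)
  fix v show "Poly_Mapping.lookup m v = Poly_Mapping.lookup m' v"
    using assms by (cases v) auto
qed

lemma place_monom_eq_iff:
  assumes "length P = length Q"
  shows "place_monom P = place_monom Q \<longleftrightarrow> P = Q"
proof
  assume eq: "place_monom P = place_monom Q"
  show "P = Q"
  proof (rule nth_equalityI[OF assms])
    fix i assume "i < length P"
    then show "P ! i = Q ! i"
      using arg_cong[OF eq, of "\<lambda>m. Poly_Mapping.lookup m (Xvar i)"]
        arg_cong[OF eq, of "\<lambda>m. Poly_Mapping.lookup m (Yvar i)"] assms
      by (simp add: lookup_place_monom_X lookup_place_monom_Y prod_eq_iff)
  qed
qed simp

lemma place_monom_add_exponents:
  "length k = length S \<Longrightarrow> place_monom (map (Pair 0) k) + place_monom S = place_monom (add_exponents S k)"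
  by (rule monom_eqI) (simp_all add: lookup_add lookup_place_monom_X lookup_place_monom_Y nth_add_exponents)

lemma place_monom_add_origin: "place_monom (add_origin n S) = place_monom S"
  by (rule monom_eqI) (simp_all add: add_origin_def lookup_place_monom_X lookup_place_monom_Y nth_append)

lemma monom_fact_place_monom: "monom_fact (place_monom P) = (\<Prod>c\<leftarrow>P. fact (fst c) * fact (snd c))"
proof -
  let ?n = "length P"
  let ?A = "Xvar ` {..<?n} \<union> Yvar ` {..<?n}"
  have "Poly_Mapping.keys (place_monom P) \<subseteq> ?A"
  proof
    fix v assume "v \<in> Poly_Mapping.keys (place_monom P)"
    then show "v \<in> ?A" by (cases v) (auto simp: in_keys_iff lookup_place_monom_X lookup_place_monom_Y split: if_splits)
  qed
  then have "monom_fact (place_monom P) = (\<Prod>v\<in>?A. fact (Poly_Mapping.lookup (place_monom P) v))"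
    by (intro monom_fact_superset) auto
  also have "\<dots> = (\<Prod>i<?n. fact (fst (P ! i))) * (\<Prod>i<?n. fact (snd (P ! i)))"
    by (subst prod.union_disjoint) (auto simp: prod.reindex inj_on_def lookup_place_monom_X lookup_place_monom_Y)
  also have "\<dots> = (\<Prod>i<?n. fact (fst (P ! i)) * fact (snd (P ! i)))"
    by (simp add: prod.distrib)
  also have "\<dots> = (\<Prod>c\<leftarrow>P. fact (fst c) * fact (snd c))"
    by (simp add: prod.list_conv_set_nth lessThan_atLeast0)
  finally show ?thesis .
qed

definition deriv_vars :: "(nat \<times> nat) list \<Rightarrow> var list" where
  "deriv_vars S = concat (map (\<lambda>i. replicate (fst (S ! i)) (Xvar i) @ replicate (snd (S ! i)) (Yvar i)) [0..<length S])"

lemma foldr_replicate: "foldr f (replicate a v) = f v ^^ a"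
  by (induction a) auto

lemma foldr_concat_map: "foldr f (concat (map g is)) p = foldr (\<lambda>i q. foldr f (g i) q) is p"
  by (induction "is") auto

lemma deriv_S_eq: "deriv_S S p = foldr partial_deriv (deriv_vars S) p"
  by (simp add: deriv_S_def deriv_vars_def foldr_concat_map foldr_replicate)

lemma sum_list_replicate_single:
  "(\<Sum>v\<leftarrow>replicate a w. Poly_Mapping.single v (1::nat)) = Poly_Mapping.single w a"
  by (induction a) (simp_all flip: single_add)

lemma sum_list_deriv_vars: "(\<Sum>v\<leftarrow>deriv_vars S. Poly_Mapping.single v 1) = place_monom S"
proof -
  have "(\<Sum>v\<leftarrow>concat (map (\<lambda>i. replicate (fst (S ! i)) (Xvar i) @ replicate (snd (S ! i)) (Yvar i)) is).
       Poly_Mapping.single v (1::nat)) =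
     (\<Sum>i\<leftarrow>is. Poly_Mapping.single (Xvar i) (fst (S ! i)) + Poly_Mapping.single (Yvar i) (snd (S ! i)))" for "is"
    by (induction "is") (simp_all only: list.map concat.simps map_append sum_list_append
        sum_list.Cons sum_list.Nil sum_list_replicate_single)
  then show ?thesis by (simp add: deriv_vars_def place_monom_def interv_sum_list_conv_sum_set_nat lessThan_atLeast0)
qed

lemma weighted_coeff_deriv_S: "weighted_coeff (deriv_S S p) m = weighted_coeff p (m + place_monom S)"
  by (simp only: deriv_S_eq weighted_coeff_foldr_partial_deriv sum_list_deriv_vars)

lemma deriv_S_add_origin: "deriv_S (add_origin n S) p = deriv_S S p"
  by (rule weighted_coeff_eqI) (simp add: weighted_coeff_deriv_S place_monom_add_origin)

section \<open>The determinant as an alternating function\<close>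

lemma Var_power: "Var v ^ a = Poly_Mapping.single (Poly_Mapping.single v a) 1"
  by (induction a) (simp_all add: Var_def mult_single flip: single_add)

lemma prod_single_1:
  "(\<Prod>i\<in>A. Poly_Mapping.single (f i) (1::rat)) = Poly_Mapping.single (\<Sum>i\<in>A. f i :: monom) 1"
  by (induction A rule: infinite_finite_induct) (simp_all add: mult_single)

lemma of_int_mult_single:
  "of_int c * Poly_Mapping.single (m :: monom) (1::rat) = Poly_Mapping.single m (of_int c)"
  by (simp add: mult_single flip: single_of_int)

lemma Delta_expansion:
  "Delta n \<mu> = (\<Sum>\<sigma> | \<sigma> permutes {0..<n}.
     Poly_Mapping.single (place_monom (map (\<lambda>i. biexponents \<mu> ! \<sigma> i) [0..<n])) (signof \<sigma>))"
proof -
  have "(\<Prod>i = 0..<n. mat n n (\<lambda>(i, j). Var (Xvar i) ^ fst (biexponents \<mu> ! j) *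
      Var (Yvar i) ^ snd (biexponents \<mu> ! j)) $$ (i, \<sigma> i)) =
    Poly_Mapping.single (place_monom (map (\<lambda>i. biexponents \<mu> ! \<sigma> i) [0..<n])) 1"
    if \<sigma>: "\<sigma> permutes {0..<n}" for \<sigma>
  proof -
    have "(\<Prod>i = 0..<n. mat n n (\<lambda>(i, j). Var (Xvar i) ^ fst (biexponents \<mu> ! j) *
        Var (Yvar i) ^ snd (biexponents \<mu> ! j)) $$ (i, \<sigma> i)) =
      (\<Prod>i = 0..<n. Poly_Mapping.single (Poly_Mapping.single (Xvar i) (fst (biexponents \<mu> ! \<sigma> i)) +
        Poly_Mapping.single (Yvar i) (snd (biexponents \<mu> ! \<sigma> i))) 1)"
      using permutes_in_image[OF \<sigma>] by (intro prod.cong) (auto simp: Var_power mult_single)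
    then show ?thesis by (simp add: prod_single_1 place_monom_def lessThan_atLeast0)
  qed
  then show ?thesis
    unfolding Delta_def
    by (subst det_def'[of _ n]) (auto simp: of_int_mult_single intro!: sum.cong)
qed

text \<open>For \<open>P\<close> an enumeration of \<open>Q\<close> this is a permutation matrix.\<close>

definition matching_matrix :: "'a list \<Rightarrow> 'a list \<Rightarrow> rat mat" where
  "matching_matrix P Q = mat (length Q) (length Q) (\<lambda>(i, j). if P ! i = Q ! j then 1 else 0)"

lemma det_matching_matrix:
  assumes "length P = length Q"
  shows "det (matching_matrix P Q) = (\<Sum>\<sigma> | \<sigma> permutes {0..<length Q}.
     if P = map (\<lambda>i. Q ! \<sigma> i) [0..<length Q] then signof \<sigma> else 0)"
proof -
  let ?n = "length Q"
  have "(\<Prod>i = 0..<?n. matching_matrix P Q $$ (i, \<sigma> i)) =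
      (if P = map (\<lambda>i. Q ! \<sigma> i) [0..<?n] then 1 else 0)" if \<sigma>: "\<sigma> permutes {0..<?n}" for \<sigma>
  proof -
    have "(\<Prod>i = 0..<?n. matching_matrix P Q $$ (i, \<sigma> i)) =
        (\<Prod>i = 0..<?n. if P ! i = Q ! \<sigma> i then 1 else 0)"
      using permutes_in_image[OF \<sigma>] by (intro prod.cong) (auto simp: matching_matrix_def)
    also have "\<dots> = (if \<forall>i<?n. P ! i = Q ! \<sigma> i then 1 else 0)"
      by (auto intro!: prod.neutral)
    also have "(\<forall>i<?n. P ! i = Q ! \<sigma> i) \<longleftrightarrow> P = map (\<lambda>i. Q ! \<sigma> i) [0..<?n]"
      unfolding list_eq_iff_nth_eq using assms by simp
    finally show ?thesis .
  qed
  then have "signof \<sigma> * (\<Prod>i = 0..<?n. matching_matrix P Q $$ (i, \<sigma> i)) =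
      (if P = map (\<lambda>i. Q ! \<sigma> i) [0..<?n] then signof \<sigma> else 0)" if "\<sigma> permutes {0..<?n}" for \<sigma>
    using that by (simp only: split: if_split) simp
  moreover have "matching_matrix P Q \<in> carrier_mat ?n ?n" by (simp add: matching_matrix_def)
  ultimately show ?thesis unfolding det_def'[OF \<open>matching_matrix P Q \<in> carrier_mat ?n ?n\<close>]
    by (intro sum.cong) blast+
qed

lemma alternating_on_det_matching_matrix:
  assumes "distinct Q"
  shows "alternating_on (set Q) (\<lambda>P. det (matching_matrix P Q))"
proof -
  let ?n = "length Q"
  have card: "card (set Q) = ?n" using assms by (rule distinct_card)
  have "det (matching_matrix P Q) \<noteq> 0 \<longleftrightarrow> distinct P \<and> set P = set Q" if P: "length P = ?n" for P
  proof
    assume "det (matching_matrix P Q) \<noteq> 0"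
    then obtain \<sigma> where "\<sigma> \<in> {\<sigma>. \<sigma> permutes {0..<?n}}"
      and "(if P = map (\<lambda>i. Q ! \<sigma> i) [0..<?n] then signof \<sigma> else 0 :: rat) \<noteq> 0"
      unfolding det_matching_matrix[OF P] by (rule sum.not_neutral_contains_not_neutral)
    then have \<sigma>: "\<sigma> permutes {0..<?n}" and "P = map (\<lambda>i. Q ! \<sigma> i) [0..<?n]"
      by (auto split: if_splits)
    then have "set P = (!) Q ` (\<sigma> ` {0..<?n})" by (simp add: image_image)
    also have "\<dots> = set Q"
      unfolding permutes_image[OF \<sigma>] by (auto simp: set_conv_nth)
    finally show "distinct P \<and> set P = set Q" using P card by (metis card_distinct)
  next
    assume "distinct P \<and> set P = set Q"
    then have "mset P = mset Q" using assms set_eq_iff_mset_eq_distinct by blast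
    then obtain \<tau> where \<tau>: "\<tau> permutes {..<?n}" "permute_list \<tau> Q = P"
      by (rule mset_eq_permutation)
    have \<tau>': "\<tau> permutes {0..<?n}" using \<tau>(1) by (simp add: lessThan_atLeast0)
    have P_eq: "P = map (\<lambda>i. Q ! \<tau> i) [0..<?n]" using \<tau>(2) by (simp add: permute_list_def)
    have uniq: "P = map (\<lambda>i. Q ! \<sigma> i) [0..<?n] \<longleftrightarrow> \<sigma> = \<tau>" if \<sigma>: "\<sigma> permutes {0..<?n}" for \<sigma>
    proof
      assume eq: "P = map (\<lambda>i. Q ! \<sigma> i) [0..<?n]"
      show "\<sigma> = \<tau>"
      proof
        fix i
        show "\<sigma> i = \<tau> i"
        proof (cases "i < ?n")
          case True
          with eq P_eq have "Q ! \<sigma> i = Q ! \<tau> i" by simp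
          moreover have "\<sigma> i < ?n" "\<tau> i < ?n"
            using True permutes_in_image[OF \<sigma>, of i] permutes_in_image[OF \<tau>', of i] by auto
          ultimately show ?thesis using assms by (simp add: nth_eq_iff_index_eq)
        next
          case False
          then show ?thesis using permutes_not_in[OF \<sigma>] permutes_not_in[OF \<tau>'] by simp
        qed
      qed
    qed (use P_eq in simp)
    have "det (matching_matrix P Q) = (\<Sum>\<sigma> | \<sigma> permutes {0..<?n}. if \<sigma> = \<tau> then signof \<sigma> else 0)"
      unfolding det_matching_matrix[OF P] using uniq by (intro sum.cong) auto
    also have "\<dots> = signof \<tau>" using \<tau>' by (simp add: sum.delta finite_permutations)
    finally show "det (matching_matrix P Q) \<noteq> 0" by (simp add: sign_def)
  qed
  moreover have "det (matching_matrix (P[i := P ! j, j := P ! i]) Q) = - det (matching_matrix P Q)"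
    if P: "length P = ?n" and ij: "i < length P" "j < length P" "i \<noteq> j" for P i j
  proof -
    have "matching_matrix (P[i := P ! j, j := P ! i]) Q = swaprows i j (matching_matrix P Q)"
      using P ij by (intro eq_matI) (auto simp: matching_matrix_def nth_list_update)
    then show ?thesis
      using det_swaprows[of i ?n j "matching_matrix P Q"] P ij by (simp add: matching_matrix_def)
  qed
  ultimately show ?thesis unfolding alternating_on_def card by simp
qed

lemma weighted_coeff_Delta:
  assumes "length P = n" "length (biexponents \<mu>) = n"
  shows "weighted_coeff (Delta n \<mu>) (place_monom P) =
     det (matching_matrix P (biexponents \<mu>)) * (\<Prod>c\<leftarrow>P. fact (fst c) * fact (snd c))"
proof -
  let ?perm = "\<lambda>\<sigma>. map (\<lambda>i. biexponents \<mu> ! \<sigma> i) [0..<n]"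
  have "place_monom (?perm \<sigma>) = place_monom P \<longleftrightarrow> P = ?perm \<sigma>" for \<sigma>
    using place_monom_eq_iff[of "?perm \<sigma>" P] assms(1) by auto
  then have "Poly_Mapping.lookup (Delta n \<mu>) (place_monom P) = (\<Sum>\<sigma> | \<sigma> permutes {0..<n}.
      if P = ?perm \<sigma> then signof \<sigma> else 0)"
    unfolding Delta_expansion lookup_sum lookup_single when_def by simp
  then show ?thesis
    using assms by (simp only: weighted_coeff_def monom_fact_place_monom det_matching_matrix)
qed

text \<open>The factorials depend only on the multiset of the entries of \<open>P\<close>, so they do not disturb the
alternating behaviour of the determinant.\<close>

lemma alternating_on_Delta:
  assumes \<mu>: "is_partition \<mu> n"
  shows "alternating_on (cells (row_lengths \<mu>)) (\<lambda>P. weighted_coeff (Delta n \<mu>) (place_monom P))"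
proof -
  have len: "length (biexponents \<mu>) = n"
    using \<mu> by (simp add: length_biexponents is_partition_def)
  have card: "card (cells (row_lengths \<mu>)) = n"
    using diagram_row_lengths[OF \<mu>] by (simp add: diagram_def)
  note alt = alternating_on_det_matching_matrix[OF distinct_biexponents, of \<mu>, unfolded set_biexponents]
  have swap: "(\<Prod>c\<leftarrow>P[i := P ! j, j := P ! i]. fact (fst c) * fact (snd c)) =
      (\<Prod>c\<leftarrow>P. fact (fst c) * fact (snd c) :: rat)"
    if "i < length P" "j < length P" for P :: "(nat \<times> nat) list" and i j
    unfolding prod_mset_prod_list[symmetric] mset_map mset_swap[OF that(2,1)] by (rule refl)
  show ?thesis
    unfolding alternating_on_def
  proof (intro conjI allI impI)
    fix P :: "(nat \<times> nat) list" assume P: "length P = card (cells (row_lengths \<mu>))"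
    have "(\<Prod>c\<leftarrow>P. fact (fst c) * fact (snd c) :: rat) \<noteq> 0" by (auto simp: prod_list_zero_iff)
    then show "weighted_coeff (Delta n \<mu>) (place_monom P) \<noteq> 0 \<longleftrightarrow> distinct P \<and> set P = cells (row_lengths \<mu>)"
      using alternating_on_nonzero_iff[OF alt P] P by (simp add: weighted_coeff_Delta len card)
    fix i j assume "i < length P" "j < length P" "i \<noteq> j"
    then show "weighted_coeff (Delta n \<mu>) (place_monom (P[i := P ! j, j := P ! i])) = - weighted_coeff (Delta n \<mu>) (place_monom P)"
      using alternating_on_swap[OF alt P, of i j] P by (simp add: weighted_coeff_Delta len card swap)
  qed
qed

section \<open>The space of x-degree zero\<close>

definition in_first_vars :: "nat \<Rightarrow> mpoly \<Rightarrow> bool" where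
  "in_first_vars n p \<longleftrightarrow> (\<forall>m i. weighted_coeff p m \<noteq> 0 \<longrightarrow> n \<le> i \<longrightarrow>
     Poly_Mapping.lookup m (Xvar i) = 0 \<and> Poly_Mapping.lookup m (Yvar i) = 0)"

lemma monom_eq_place_monom:
  assumes "\<And>i. n \<le> i \<Longrightarrow> Poly_Mapping.lookup m (Xvar i) = 0"
    "\<And>i. n \<le> i \<Longrightarrow> Poly_Mapping.lookup m (Yvar i) = 0"
  shows "m = place_monom (map (\<lambda>i. (Poly_Mapping.lookup m (Xvar i), Poly_Mapping.lookup m (Yvar i))) [0..<n])"
  by (rule monom_eqI) (use assms in \<open>auto simp: lookup_place_monom_X lookup_place_monom_Y\<close>)

lemma in_first_vars_shift:
  assumes "in_first_vars n p" "\<And>m. weighted_coeff q m = weighted_coeff p (m + e)"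
  shows "in_first_vars n q"
  unfolding in_first_vars_def
proof (intro allI impI)
  fix m i assume "weighted_coeff q m \<noteq> 0" "n \<le> i"
  with assms have "Poly_Mapping.lookup (m + e) (Xvar i) = 0 \<and> Poly_Mapping.lookup (m + e) (Yvar i) = 0"
    unfolding in_first_vars_def by metis
  then show "Poly_Mapping.lookup m (Xvar i) = 0 \<and> Poly_Mapping.lookup m (Yvar i) = 0"
    by (simp add: lookup_add)
qed

lemma in_first_vars_add:
  assumes "in_first_vars n p" "in_first_vars n q"
  shows "in_first_vars n (p + q)"
  unfolding in_first_vars_def weighted_coeff_add
proof (intro allI impI)
  fix m i assume "weighted_coeff p m + weighted_coeff q m \<noteq> 0" and i: "n \<le> i"
  then have "weighted_coeff p m \<noteq> 0 \<or> weighted_coeff q m \<noteq> 0" by auto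
  with assms i show "Poly_Mapping.lookup m (Xvar i) = 0 \<and> Poly_Mapping.lookup m (Yvar i) = 0"
    unfolding in_first_vars_def by blast
qed

lemma in_first_vars_Delta: "in_first_vars n (Delta n \<mu>)"
  unfolding in_first_vars_def
proof (intro allI impI)
  fix m i assume "weighted_coeff (Delta n \<mu>) m \<noteq> 0" and i: "n \<le> i"
  then have "Poly_Mapping.lookup (Delta n \<mu>) m \<noteq> 0" by (simp add: weighted_coeff_def)
  then obtain \<sigma> where "Poly_Mapping.lookup (Poly_Mapping.single
      (place_monom (map (\<lambda>i. biexponents \<mu> ! \<sigma> i) [0..<n])) (signof \<sigma> :: rat)) m \<noteq> 0"
    unfolding Delta_expansion lookup_sum by (rule sum.not_neutral_contains_not_neutral)
  then have "m = place_monom (map (\<lambda>i. biexponents \<mu> ! \<sigma> i) [0..<n])"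
    by (auto simp: lookup_single when_def split: if_splits)
  with i show "Poly_Mapping.lookup m (Xvar i) = 0 \<and> Poly_Mapping.lookup m (Yvar i) = 0"
    by (simp add: lookup_place_monom_X lookup_place_monom_Y)
qed

text \<open>Restricting to monomials in the \<open>y\<close>'s acts as the projection onto \<open>x\<close>-degree \<open>0\<close>, so that properties of
\<open>y_coeffs f\<close> can be checked on the generators of \<open>M\<^sub>\<mu>\<close>, whatever their \<open>x\<close>-degree.\<close>

definition y_coeffs :: "mpoly \<Rightarrow> nat list \<Rightarrow> rat" where
  "y_coeffs p k = weighted_coeff p (place_monom (map (Pair 0) k))"

lemma y_coeffs_eqI:
  assumes "in_first_vars n p" "in_first_vars n q"
    and "\<And>m i. m \<in> Poly_Mapping.keys p \<Longrightarrow> Poly_Mapping.lookup m (Xvar i) = 0"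
    and "\<And>m i. m \<in> Poly_Mapping.keys q \<Longrightarrow> Poly_Mapping.lookup m (Xvar i) = 0"
    and eq: "\<And>k. length k = n \<Longrightarrow> y_coeffs p k = y_coeffs q k"
  shows "p = q"
proof (rule weighted_coeff_eqI)
  fix m
  show "weighted_coeff p m = weighted_coeff q m"
  proof (cases "weighted_coeff p m = 0 \<and> weighted_coeff q m = 0")
    case False
    then have X: "Poly_Mapping.lookup m (Xvar i) = 0" for i
      using assms(3,4) weighted_coeff_nonzero_iff by blast
    have Y: "Poly_Mapping.lookup m (Yvar i) = 0" if "n \<le> i" for i
      using False assms(1,2) that unfolding in_first_vars_def by blast
    have "m = place_monom (map (Pair 0) (map (\<lambda>i. Poly_Mapping.lookup m (Yvar i)) [0..<n]))"
      by (rule monom_eqI) (auto simp: lookup_place_monom_X lookup_place_monom_Y X Y)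
    with eq[of "map (\<lambda>i. Poly_Mapping.lookup m (Yvar i)) [0..<n]"] show ?thesis
      by (simp add: y_coeffs_def)
  qed simp
qed

lemma tanisaki_kernel_cong:
  assumes "g \<in> tanisaki_kernel n m" "\<And>k. length k = n \<Longrightarrow> f k = g k"
  shows "f \<in> tanisaki_kernel n m"
proof -
  have "elem_sym_shift ts r f k = elem_sym_shift ts r g k" if "length ts = n" "length k = n" for ts r k
    unfolding elem_sym_shift_def using that
    by (intro sum.cong[OF refl] assms(2)) (simp add: length_selections)
  with assms(1) show ?thesis by (simp add: tanisaki_kernel_def)
qed

lemma y_coeffs_deriv_S:
  "length S = n \<Longrightarrow> length k = n \<Longrightarrow> y_coeffs (deriv_S S p) k = weighted_coeff p (place_monom (add_exponents S k))"
  by (simp add: y_coeffs_def weighted_coeff_deriv_S place_monom_add_exponents)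

text \<open>On monomials in the \<open>y\<close>'s, a derivative of \<open>\<Delta>\<^sub>\<mu>\<close> has the weighted coefficients
\<open>F (add_exponents S k)\<close>, where \<open>S\<close> lists the orders of differentiation at each place.\<close>

lemma M_space_properties:
  assumes \<mu>: "is_partition \<mu> n" and f: "f \<in> M_space n \<mu>"
  shows "in_first_vars n f \<and> y_coeffs f \<in> tanisaki_kernel n (row_lengths \<mu>)"
  using f unfolding M_space_def
proof (induction rule: mpoly.span_induct)
  case base
  show ?case
  proof (rule mpoly.subspaceI)
    show "0 \<in> {f. in_first_vars n f \<and> y_coeffs f \<in> tanisaki_kernel n (row_lengths \<mu>)}"
      using tanisaki_kernel_zero by (simp add: in_first_vars_def y_coeffs_def[abs_def] weighted_coeff_zero)
  next
    fix f g
    assume "f \<in> {f. in_first_vars n f \<and> y_coeffs f \<in> tanisaki_kernel n (row_lengths \<mu>)}"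
      and "g \<in> {f. in_first_vars n f \<and> y_coeffs f \<in> tanisaki_kernel n (row_lengths \<mu>)}"
    then show "f + g \<in> {f. in_first_vars n f \<and> y_coeffs f \<in> tanisaki_kernel n (row_lengths \<mu>)}"
      using tanisaki_kernel_add[of "y_coeffs f" n "row_lengths \<mu>" "y_coeffs g"]
      by (simp add: in_first_vars_add y_coeffs_def[abs_def] weighted_coeff_add)
  next
    fix c f
    assume "f \<in> {f. in_first_vars n f \<and> y_coeffs f \<in> tanisaki_kernel n (row_lengths \<mu>)}"
    then show "scale c f \<in> {f. in_first_vars n f \<and> y_coeffs f \<in> tanisaki_kernel n (row_lengths \<mu>)}"
      using tanisaki_kernel_scale[of "y_coeffs f" n "row_lengths \<mu>" c]
      by (auto simp: in_first_vars_def y_coeffs_def[abs_def] weighted_coeff_scale)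
  qed
next
  case (step f)
  then obtain vs where vs: "set vs \<subseteq> Xvar ` {..<n} \<union> Yvar ` {..<n}"
    and f: "f = foldr partial_deriv vs (Delta n \<mu>)" by blast
  define e where "e = (\<Sum>v\<leftarrow>vs. Poly_Mapping.single v (1::nat))"
  have weighted_coeff: "weighted_coeff f m = weighted_coeff (Delta n \<mu>) (m + e)" for m
    unfolding f e_def by (rule weighted_coeff_foldr_partial_deriv)
  have zero: "Poly_Mapping.lookup e v = 0" if "v \<notin> set vs" for v
    using that unfolding e_def by (induction vs) (auto simp: lookup_add lookup_single when_def)
  have "Poly_Mapping.lookup e (Xvar i) = 0" "Poly_Mapping.lookup e (Yvar i) = 0" if "n \<le> i" for i
    by (rule zero, use vs that in auto)+
  note e_eq = monom_eq_place_monom[OF this]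
  define S where "S = map (\<lambda>i. (Poly_Mapping.lookup e (Xvar i), Poly_Mapping.lookup e (Yvar i))) [0..<n]"
  have S: "e = place_monom S" "length S = n" using e_eq unfolding S_def by simp_all
  have "y_coeffs f k = weighted_coeff (Delta n \<mu>) (place_monom (add_exponents S k))" if "length k = n" for k
    using that S by (simp add: y_coeffs_def weighted_coeff place_monom_add_exponents)
  with add_exponents_in_tanisaki_kernel[OF diagram_row_lengths[OF \<mu>] alternating_on_Delta[OF \<mu>] S(2)]
  have "y_coeffs f \<in> tanisaki_kernel n (row_lengths \<mu>)" by (rule tanisaki_kernel_cong)
  moreover have "in_first_vars n f" using in_first_vars_shift[OF in_first_vars_Delta weighted_coeff] .
  ultimately show ?case by simp
qed

lemma sum_fst_corner_collections:
  "diagram n m \<Longrightarrow> S \<in> corner_collections n m \<Longrightarrow> (\<Sum>c\<leftarrow>S. fst c) = (\<Sum>c\<in>cells m. fst c)"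
proof (induction n arbitrary: m S)
  case 0
  then have "cells m = {}" by (metis card_0_eq diagram_def)
  with 0 show ?case by simp
next
  case (Suc n)
  then obtain p b S' where pb: "(p, b) \<in> corner_choices m"
    and S: "S' \<in> corner_collections n (remove_corner p m)" "S = (p, b) # S'"
    unfolding corner_collections.simps by blast
  have "diagram n (remove_corner p m)"
    by (rule diagram_remove_corner[OF Suc.prems(1)]) (use pb in \<open>simp add: corner_choices_def\<close>)
  from Suc.IH[OF this S(1)]
  have "(\<Sum>c\<leftarrow>S. fst c) = p + (\<Sum>c\<in>cells m - {(p, m p - 1)}. fst c)"
    unfolding S(2) cells_remove_corner by simp
  also have "\<dots> = (\<Sum>c\<in>cells m. fst c)"
    using sum.remove[OF _ corner_mem_cells[OF pb], of fst] Suc.prems(1) by (simp add: diagram_def)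
  finally show ?case .
qed

text \<open>Each term of \<open>\<Delta>\<^sub>\<mu>\<close> has as \<open>x\<close>-degree the sum of the first coordinates of all cells.  A collection
takes exactly as many \<open>x\<close>-derivatives, by \<open>sum_fst_corner_collections\<close>.\<close>

lemma deriv_S_in_M0_space:
  assumes \<mu>: "is_partition \<mu> n" and S: "S \<in> corner_collections n (row_lengths \<mu>)"
  shows "deriv_S S (Delta n \<mu>) \<in> M0_space n \<mu>"
proof -
  note m = diagram_row_lengths[OF \<mu>]
  have lenS: "length S = n" using S by (rule length_corner_collections)
  have "set (deriv_vars S) \<subseteq> Xvar ` {..<n} \<union> Yvar ` {..<n}"
    by (auto simp: deriv_vars_def lenS split: if_splits)
  then have M: "deriv_S S (Delta n \<mu>) \<in> M_space n \<mu>"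
    unfolding M_space_def deriv_S_eq by (intro mpoly.span_base) blast
  moreover have "Poly_Mapping.lookup l (Xvar i) = 0" if l: "l \<in> Poly_Mapping.keys (deriv_S S (Delta n \<mu>))" for l i
  proof -
    define Q where "Q = map (\<lambda>i. (Poly_Mapping.lookup l (Xvar i), Poly_Mapping.lookup l (Yvar i))) [0..<n]"
    define P where "P = map (\<lambda>i. (fst (Q ! i) + fst (S ! i), snd (Q ! i) + snd (S ! i))) [0..<n]"
    have nz: "weighted_coeff (deriv_S S (Delta n \<mu>)) l \<noteq> 0" using l by (simp add: weighted_coeff_nonzero_iff)
    then have sup: "Poly_Mapping.lookup l (Xvar i) = 0" "Poly_Mapping.lookup l (Yvar i) = 0" if "n \<le> i" for i
      using M_space_properties[OF \<mu> M] that unfolding in_first_vars_def by blast+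
    have l_eq: "l = place_monom Q" unfolding Q_def by (rule monom_eq_place_monom[OF sup])
    have lenQ: "length Q = n" by (simp add: Q_def)
    have "place_monom Q + place_monom S = place_monom P"
      by (rule monom_eqI) (auto simp: lookup_add lookup_place_monom_X lookup_place_monom_Y P_def lenQ lenS)
    with nz have "weighted_coeff (Delta n \<mu>) (place_monom P) \<noteq> 0" by (simp add: weighted_coeff_deriv_S l_eq)
    moreover have "length P = card (cells (row_lengths \<mu>))" using m by (simp add: P_def diagram_def)
    ultimately have "distinct P" "set P = cells (row_lengths \<mu>)"
      using alternating_on_nonzero_iff[OF alternating_on_Delta[OF \<mu>]] by blast+
    then have "(\<Sum>c\<in>cells (row_lengths \<mu>). fst c) = (\<Sum>c\<leftarrow>P. fst c)"
      using sum_list_distinct_conv_sum_set[of P fst] by simp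
    also have "\<dots> = (\<Sum>i<n. fst (Q ! i) + fst (S ! i))"
      by (simp add: P_def comp_def interv_sum_list_conv_sum_set_nat lessThan_atLeast0)
    also have "\<dots> = (\<Sum>i<n. fst (Q ! i)) + (\<Sum>c\<leftarrow>S. fst c)"
      by (simp add: sum.distrib sum_list_sum_nth lenS lessThan_atLeast0)
    finally have "(\<Sum>i<n. fst (Q ! i)) = 0"
      using sum_fst_corner_collections[OF m S] by simp
    then have "fst (Q ! i) = 0" if "i < n" for i using that by simp
    then show ?thesis by (simp add: l_eq lookup_place_monom_X lenQ)
  qed
  ultimately show ?thesis unfolding M0_space_def by blast
qed

lemma subspace_M0_space: "mpoly.subspace (M0_space n \<mu>)"
proof (rule mpoly.subspaceI)
  have M: "mpoly.subspace (M_space n \<mu>)" unfolding M_space_def by (rule mpoly.subspace_span)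
  show "0 \<in> M0_space n \<mu>" using mpoly.subspace_0[OF M] by (simp add: M0_space_def)
  show "f + g \<in> M0_space n \<mu>" if "f \<in> M0_space n \<mu>" "g \<in> M0_space n \<mu>" for f g
    using that mpoly.subspace_add[OF M, of f g] Poly_Mapping.keys_add[of f g]
    unfolding M0_space_def by blast
  show "scale c f \<in> M0_space n \<mu>" if "f \<in> M0_space n \<mu>" for c f
  proof -
    have "Poly_Mapping.keys (scale c f) \<subseteq> Poly_Mapping.keys f"
      by (auto simp: weighted_coeff_scale simp flip: weighted_coeff_nonzero_iff)
    then show ?thesis using that mpoly.subspace_scale[OF M, of f c] unfolding M0_space_def by blast
  qed
qed

lemma inj_on_independent_if_only_trivial_relation:
  assumes fin: "finite A"
    and trivial: "\<And>u a. (\<Sum>a\<in>A. scale (u a) (f a)) = 0 \<Longrightarrow> a \<in> A \<Longrightarrow> u a = 0"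
  shows "inj_on f A \<and> mpoly.independent (f ` A)"
proof
  show inj: "inj_on f A"
  proof (rule inj_onI, rule ccontr)
    fix a b assume ab: "a \<in> A" "b \<in> A" "f a = f b" "a \<noteq> b"
    define u :: "'a \<Rightarrow> rat" where "u c = (if c = a then 1 else if c = b then - 1 else 0)" for c
    have "(\<Sum>c\<in>A. scale (u c) (f c)) = (\<Sum>c\<in>{a, b}. scale (u c) (f c))"
      using ab fin by (intro sum.mono_neutral_right) (auto simp: u_def)
    also have "\<dots> = 0" using ab by (simp add: u_def mpoly.scale_minus_left)
    finally have "u a = 0" using trivial ab(1) by blast
    then show False by (simp add: u_def)
  qed
  show "mpoly.independent (f ` A)"
  proof (rule mpoly.independent_if_scalars_zero)
    show "finite (f ` A)" using fin by simp
    fix u x assume 0: "(\<Sum>x\<in>f ` A. scale (u x) x) = 0" and "x \<in> f ` A"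
    then obtain a where a: "a \<in> A" "x = f a" by blast
    have "(\<Sum>a\<in>A. scale (u (f a)) (f a)) = 0" using 0 by (simp add: sum.reindex[OF inj])
    from trivial[OF this a(1)] a show "u x = 0" by simp
  qed
qed

lemma corner_collections_basis:
  fixes n :: nat and \<mu> :: "nat list"
  assumes \<mu>: "is_partition \<mu> n"
  defines "B \<equiv> \<lambda>S. deriv_S S (Delta n \<mu>)" and "C \<equiv> corner_collections n (row_lengths \<mu>)"
  shows "inj_on B C \<and> mpoly.independent (B ` C) \<and> mpoly.span (B ` C) = M0_space n \<mu>"
proof -
  note m = diagram_row_lengths[OF \<mu>] and alt = alternating_on_Delta[OF \<mu>]
  have fin: "finite C" unfolding C_def by (rule finite_corner_collections[OF m])
  have y_comb: "y_coeffs (\<Sum>S\<in>C. scale (u S) (B S)) k =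
      (\<Sum>S\<in>C. u S * weighted_coeff (Delta n \<mu>) (place_monom (add_exponents S k)))" if "length k = n" for u k
  proof -
    have "y_coeffs (B S) k = weighted_coeff (Delta n \<mu>) (place_monom (add_exponents S k))" if "S \<in> C" for S
      using that \<open>length k = n\<close> unfolding B_def C_def
      by (intro y_coeffs_deriv_S) (simp_all add: length_corner_collections)
    then show ?thesis by (simp add: y_coeffs_def weighted_coeff_sum weighted_coeff_scale)
  qed
  have B_mem: "B S \<in> M0_space n \<mu>" if "S \<in> C" for S
    using that unfolding B_def C_def by (rule deriv_S_in_M0_space[OF \<mu>])
  have "u S = 0" if "(\<Sum>S\<in>C. scale (u S) (B S)) = 0" "S \<in> C" for u S
  proof (rule corner_collections_independent[OF m alt, of u])
    show "(\<Sum>S\<in>corner_collections n (row_lengths \<mu>). u S * weighted_coeff (Delta n \<mu>) (place_monom (add_exponents S k))) = 0"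
      if "length k = n" for k
      using y_comb[OF that, of u] \<open>(\<Sum>S\<in>C. scale (u S) (B S)) = 0\<close>
      by (simp add: C_def y_coeffs_def weighted_coeff_zero)
  qed (use that in \<open>simp add: C_def\<close>)
  then have ind: "inj_on B C \<and> mpoly.independent (B ` C)"
    by (rule inj_on_independent_if_only_trivial_relation[OF fin])
  have "mpoly.span (B ` C) = M0_space n \<mu>"
  proof
    show "mpoly.span (B ` C) \<subseteq> M0_space n \<mu>"
      using B_mem by (intro mpoly.span_minimal subspace_M0_space) blast
    show "M0_space n \<mu> \<subseteq> mpoly.span (B ` C)"
    proof
      fix f assume f: "f \<in> M0_space n \<mu>"
      have props: "in_first_vars n h \<and> y_coeffs h \<in> tanisaki_kernel n (row_lengths \<mu>)" if "h \<in> M0_space n \<mu>" for h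
        using that M_space_properties[OF \<mu>] unfolding M0_space_def by blast
      obtain u where u: "\<And>k. length k = n \<Longrightarrow>
          y_coeffs f k = (\<Sum>S\<in>C. u S * weighted_coeff (Delta n \<mu>) (place_monom (add_exponents S k)))"
        using corner_collections_span[OF m alt, of "y_coeffs f"] props[OF f] unfolding C_def by blast
      define g where "g = (\<Sum>S\<in>C. scale (u S) (B S))"
      have g: "g \<in> M0_space n \<mu>"
        unfolding g_def
        by (intro mpoly.subspace_sum mpoly.subspace_scale subspace_M0_space B_mem)
      have "f = g"
      proof (rule y_coeffs_eqI)
        show "in_first_vars n f" "in_first_vars n g" using props f g by blast+
        show "Poly_Mapping.lookup l (Xvar i) = 0" if "l \<in> Poly_Mapping.keys f" for l i
          using that f unfolding M0_space_def by blast
        show "Poly_Mapping.lookup l (Xvar i) = 0" if "l \<in> Poly_Mapping.keys g" for l i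
          using that g unfolding M0_space_def by blast
        show "y_coeffs f k = y_coeffs g k" if "length k = n" for k
          unfolding g_def u[OF that] y_comb[OF that] ..
      qed
      also have "g \<in> mpoly.span (B ` C)"
        unfolding g_def by (intro mpoly.span_sum mpoly.span_scale mpoly.span_base) blast
      finally show "f \<in> mpoly.span (B ` C)" .
    qed
  qed
  with ind show ?thesis by blast
qed

theorem theorem4:
  fixes n :: nat and \<mu> :: "nat list"
  assumes "is_partition \<mu> n"
  shows "inj_on (\<lambda>S. deriv_S S (Delta n \<mu>)) (crossed_collections \<mu>) \<and>
    mpoly.independent ((\<lambda>S. deriv_S S (Delta n \<mu>)) ` crossed_collections \<mu>) \<and>
    mpoly.span ((\<lambda>S. deriv_S S (Delta n \<mu>)) ` crossed_collections \<mu>) = M0_space n \<mu>"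
proof -
  let ?B = "\<lambda>S. deriv_S S (Delta n \<mu>)"
  have B: "?B \<circ> add_origin n = ?B" by (simp add: fun_eq_iff deriv_S_add_origin)
  have img: "?B ` corner_collections n (row_lengths \<mu>) = ?B ` crossed_collections \<mu>"
    unfolding add_origin_crossed_collections[OF assms, symmetric] image_comp B ..
  have "inj_on (?B \<circ> add_origin n) (crossed_collections \<mu>)"
    using corner_collections_basis[OF assms] inj_on_subset[OF inj_add_origin]
    unfolding add_origin_crossed_collections[OF assms, symmetric] by (blast intro: comp_inj_on)
  then show ?thesis using corner_collections_basis[OF assms] unfolding img B by blast
qed

end
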